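(* Let $N\ge 1$ be an integer and let $s\in(0,1)$. There exists $\varepsilon_{N,s}>0$ such that the function $u=\mathbf 1_{B_2}+\mathbf 1_{B_1(\mathrm e_1)}$ on $\mathbb R^N$ and its symmetric decreasing rearrangement $u^\star=\mathbf 1_{B_2}+\mathbf 1_{B_1}$ satisfy $$\|\nabla^s u^\star\|_{L^p(\mathbb R^N)}>\|\nabla^s u\|_{L^p(\mathbb R^N)}\qquad\text{for every } p\in[1,1+\varepsilon_{N,s}].$$
   Context: $B_r(c)$ is the open ball in $\mathbb R^N$ of center $c$ and radius $r$, $B_r=B_r(0)$, and $\mathrm e_1$ is the first vector of the canonical basis of $\mathbb R^N$. $\mathbf 1_E$ is the characteristic function of $E$. Fractional gradient and divergence: fix a normalization constant $c_{N,s}>0$ (its precise value plays no role). For $u\in\mathrm{Lip}_c(\mathbb R^N)$ (Lipschitz with compact support), the Riesz fractional $s$-gradient is $$\nabla^s u(x)=c_{N,s}\int_{\mathbb R^N}\frac{(u(y)-u(x))(y-x)}{|y-x|^{N+s+1}}\,\mathrm dy,\quad x\in\mathbb R^N,$$ and for $\varphi\in C^\infty_c(\mathbb R^N;\mathbb R^N)$ the fractional $s$-divergence is $$\mathrm{div}^s\varphi(x)=c_{N,s}\int_{\mathbb R^N}\frac{(\varphi(y)-\varphi(x))\cdot(y-x)}{|y-x|^{N+s+1}}\,\mathrm dy,\quad x\in\mathbb R^N.$$ For $u\in BV(\mathbb R^N)\cap L^\infty(\mathbb R^N)$ (in particular for finite sums of characteristic functions of balls), $\nabla^s u$ is understood in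 the distributional sense: it is the (a.e. unique) function in $L^1(\mathbb R^N;\mathbb R^N)$ such that $\int_{\mathbb R^N}u\,\mathrm{div}^s\varphi\,\mathrm dx=-\int_{\mathbb R^N}\varphi\cdot\nabla^s u\,\mathrm dx$ for all $\varphi\in C^\infty_c(\mathbb R^N;\mathbb R^N)$. For finite sums of characteristic functions of balls it is given by the same integral formula at every point $x$ not on the boundary of any of the balls. Symmetric decreasing rearrangement: for a non-negative measurable $u$ on $\mathbb R^N$ whose superlevel sets $\{u>\lambda\}$, $\lambda>0$, have finite measure, $u^\star(x)=\int_0^\infty\mathbf 1_{\{u>\lambda\}^\star}(x)\,\mathrm d\lambda$, where $E^\star$ is the open ball centered at the origin with $|E^\star|=|E|$. $\|\nabla^s u\|_{L^p}$ denotes the $L^p(\mathbb R^N)$ norm of $|\nabla^s u|$, with $|\cdot|$ the Euclidean norm. *)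

theory Defs
  imports "HOL-Analysis.Analysis"
begin

text \<open>
  Everything is stated over an arbitrary Euclidean space \<open>'a\<close>, with \<open>DIM('a)\<close> in the role of \<open>N\<close>.
\<close>

fun Ck :: "nat \<Rightarrow> ('a::euclidean_space \<Rightarrow> 'b::real_normed_vector) \<Rightarrow> bool" where
  "Ck 0 f \<longleftrightarrow> continuous_on UNIV f"
| "Ck (Suc k) f \<longleftrightarrow> (\<forall>x. f differentiable (at x)) \<and>
     (\<forall>v. Ck k (\<lambda>x. frechet_derivative f (at x) v))"

definition test_field :: "('a::euclidean_space \<Rightarrow> 'a) \<Rightarrow> bool" where
  "test_field \<phi> \<longleftrightarrow> (\<forall>k. Ck k \<phi>) \<and> compact (closure {x. \<phi> x \<noteq> 0})"

text \<open>
  The integral converges absolutely for \<open>0 < s < 1\<close> and \<open>\<phi>\<close> Lipschitz with compact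
  support; the integrand has the value 0 at \<open>y = x\<close>. The parameter \<open>c\<close> is the
  normalization constant.
\<close>

definition frac_div :: "real \<Rightarrow> real \<Rightarrow> ('a::euclidean_space \<Rightarrow> 'a) \<Rightarrow> 'a \<Rightarrow> real" where
  "frac_div c s \<phi> x =
     c * (LINT y|lborel. ((\<phi> y - \<phi> x) \<bullet> (y - x)) / norm (y - x) powr (real DIM('a) + s + 1))"

definition is_frac_grad ::
    "real \<Rightarrow> real \<Rightarrow> ('a::euclidean_space \<Rightarrow> real) \<Rightarrow> ('a \<Rightarrow> 'a) \<Rightarrow> bool" where
  "is_frac_grad c s u g \<longleftrightarrow> integrable lborel g \<and>
     (\<forall>\<phi>. test_field \<phi> \<longrightarrow>
        (LINT x|lborel. u x * frac_div c s \<phi> x) = - (LINT x|lborel. \<phi> x \<bullet> g x))"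

text \<open>
  The distributional fractional gradient is determined only up to null sets, so a
  representative is chosen; it is meaningful when \<open>u\<close> has one, e.g. for \<open>u\<close> bounded and
  of bounded variation.
\<close>

definition frac_grad :: "real \<Rightarrow> real \<Rightarrow> ('a::euclidean_space \<Rightarrow> real) \<Rightarrow> 'a \<Rightarrow> 'a" where
  "frac_grad c s u = (SOME g. is_frac_grad c s u g)"

text \<open>The norm takes values in \<open>[0, \<infinity>]\<close>; it is intended for real exponents \<open>p \<ge> 1\<close>.\<close>

definition Lp_norm :: "real \<Rightarrow> ('a::euclidean_space \<Rightarrow> 'b::real_normed_vector) \<Rightarrow> ennreal" where
  "Lp_norm p f =
     (let I = \<integral>\<^sup>+ x. ennreal (norm (f x) powr p) \<partial>lborel
      in if I = \<infinity> then \<infinity> else ennreal (enn2real I powr (1 / p)))"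

text \<open>
  For measurable \<open>E\<close> of finite measure there is exactly one such ball as a set (all radii
  \<open>r \<le> 0\<close> give the empty ball).
\<close>

definition set_rearr :: "'a::euclidean_space set \<Rightarrow> 'a set" where
  "set_rearr E = (THE B. (\<exists>r. B = ball 0 r) \<and> emeasure lebesgue B = emeasure lebesgue E)"

text \<open>
  Real-valued: for \<open>u\<close> unbounded above the integral diverges at \<open>x = 0\<close> (and only there),
  where it takes the value 0 by convention.
\<close>

definition sym_decr_rearr :: "('a::euclidean_space \<Rightarrow> real) \<Rightarrow> 'a \<Rightarrow> real" where
  "sym_decr_rearr u x = (LINT t:{0<..}|lborel. indicat_real (set_rearr {y. u y > t}) x)"

end

theory Submission
  imports Defs
begin

text \<open>
  Write \<open>G R\<close> for the fractional gradient of the indicator of the ball of radius \<open>R\<close> about the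
  origin. It points towards the centre: \<open>G R x = - \<gamma> x\<close> with \<open>\<gamma> \<ge> 0\<close>, and \<open>\<gamma> > 0\<close> for
  \<open>0 < |x| < R\<close> (\<open>riesz_grad_ball_radial\<close>). So for two concentric balls the gradients are
  parallel almost everywhere, and the \<open>L\<^sup>1\<close> norm of their sum is the sum of their \<open>L\<^sup>1\<close> norms. If the
  small ball is moved to the centre \<open>e\<close>, its own \<open>L\<^sup>1\<close> norm does not change, but the triangle
  inequality is now strict on a set of positive measure: for \<open>x\<close> in the ball with diameter from
  \<open>0\<close> to \<open>e\<close> one has \<open>x \<bullet> (x - e) < 0\<close>, so the two gradients point away from each other. This is
  the case \<open>p = 1\<close> (\<open>integral_norm_riesz_grad_balls_less\<close>). The gradients are integrable
  and bounded by a constant times \<open>d powr (- s)\<close>, where \<open>d\<close> is the distance to the sphere, hence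
  they lie in \<open>L\<^sup>q\<close> for some \<open>q > 1\<close>; by dominated convergence both norms are right-continuous at \<open>p = 1\<close>
  (\<open>Lp_norm_tendsto_1\<close>), and the strict inequality survives for \<open>p\<close> slightly above \<open>1\<close>.

  Most of the work lies in connecting the distributional gradient with the singular integral. Any
  integrable \<open>u\<close> of finite Gagliardo seminorm satisfies the duality formula with the singular
  integral in the role of the gradient (\<open>is_frac_grad_riesz_grad\<close>): after exchanging the two
  variables in one of the double integrals, the two sides add up to a double integral of
  \<open>(\<psi> y - \<psi> x) \<bullet> k (y - x)\<close> with \<open>\<psi> = u \<phi>\<close>, which vanishes by integrating in \<open>x\<close> first with
  \<open>y - x\<close> fixed. Uniqueness almost everywhere (\<open>AE_zero_if_orthogonal_to_test_fields\<close>) holds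
  because indicators of boxes are limits of smooth bumps. Balls have finite Gagliardo seminorm
  because the \<open>t\<close>-neighbourhood of a sphere has measure \<open>O(t)\<close> and \<open>s < 1\<close>.
\<close>

section \<open>Invariance of Lebesgue measure under translations and isometries\<close>

lemma nn_integral_lborel_shift:
  fixes f :: "'a::euclidean_space \<Rightarrow> ennreal"
  assumes [measurable]: "f \<in> borel_measurable borel"
  shows "(\<integral>\<^sup>+x. f (c + x) \<partial>lborel) = (\<integral>\<^sup>+x. f x \<partial>lborel)"
proof -
  have "(\<integral>\<^sup>+x. f x \<partial>lborel) = (\<integral>\<^sup>+x. f x \<partial>distr lborel borel ((+) c))"
    by (simp add: lborel_distr_plus)
  then show ?thesis
    by (simp add: nn_integral_distr)
qed

lemma integral_lborel_shift:
  fixes f :: "'a::euclidean_space \<Rightarrow> 'b::{banach, second_countable_topology}"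
  assumes [measurable]: "f \<in> borel_measurable borel"
  shows "(LINT x|lborel. f (c + x)) = (LINT x|lborel. f x)"
  using integral_distr[of "(+) c" lborel borel f] by (simp add: lborel_distr_plus)

lemma integrable_lborel_shift:
  fixes f :: "'a::euclidean_space \<Rightarrow> 'b::{banach, second_countable_topology}"
  assumes "integrable lborel f"
  shows "integrable lborel (\<lambda>x. f (c + x))"
  using assms integrable_distr[of "(+) c" lborel borel f] by (simp add: lborel_distr_plus)

text \<open>
  Uniqueness of Haar measure. For a translation-invariant measure \<open>\<mu>\<close>, Tonelli's theorem gives
  \<open>\<mu>(A) \<lambda>(B) = \<mu>(B) \<lambda>(- A)\<close>, where \<open>\<lambda>\<close> is Lebesgue measure. For \<open>\<mu> = distr lborel borel T\<close> the
  unit ball \<open>B\<close> has \<open>\<mu>(B) = \<lambda>(B)\<close>, hence \<open>\<mu>(A) = \<lambda>(- A)\<close>; the case \<open>T = id\<close> then removes the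
  minus sign.
\<close>

lemma distr_lborel_isometry:
  fixes T :: "'a::euclidean_space \<Rightarrow> 'a"
  assumes T: "linear T" "\<And>x. norm (T x) = norm x"
  shows "distr lborel borel T = lborel"
proof -
  have key: "emeasure lborel (T -` A) = (\<integral>\<^sup>+y. indicator A (- y) \<partial>lborel)"
    if T: "linear T" "\<And>x. norm (T x) = norm x" and A[measurable]: "A \<in> sets borel"
    for T :: "'a \<Rightarrow> 'a" and A
  proof -
    define B where "B = ball (0::'a) 1"
    have [measurable]: "B \<in> sets borel" by (simp add: B_def)
    have [measurable]: "T \<in> borel_measurable borel"
      using T(1) by (intro borel_measurable_continuous_onI linear_continuous_on)
        (simp add: linear_conv_bounded_linear)
    have "inj T"
    proof (rule injI)
      fix x y assume "T x = T y"
      then have "norm (T (x - y)) = 0" using linear_diff[OF T(1)] by simp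
      then show "x = y" using T(2) by simp
    qed
    then have surj: "surj T"
      using T(1) by (simp add: linear_injective_imp_surjective)
    have BT: "indicator B (T x) = (indicator B x :: ennreal)" for x
      by (simp add: B_def indicator_def T(2))
    have B: "(\<integral>\<^sup>+y. indicator B y \<partial>lborel) = ennreal (unit_ball_vol (real DIM('a)))"
      unfolding B_def by (simp add: emeasure_ball)
    have B0: "0 < unit_ball_vol (real DIM('a))"
      by simp
    have "emeasure lborel (T -` A) * (\<integral>\<^sup>+y. indicator B y \<partial>lborel)
        = (\<integral>\<^sup>+x. (\<integral>\<^sup>+y. indicator A (T x) * indicator B y \<partial>lborel) \<partial>lborel)"
    proof -
      have "T -` A \<in> sets borel"
        using measurable_sets[of T borel borel A] by simp
      then have "emeasure lborel (T -` A) = (\<integral>\<^sup>+x. indicator A (T x) \<partial>lborel)"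
        using nn_integral_indicator[of "T -` A" lborel] by (simp add: indicator_def)
      then show ?thesis
        by (simp add: nn_integral_cmult nn_integral_multc)
    qed
    \<comment> \<open>Translate \<open>y\<close> by \<open>T x\<close>, exchange the integrals and translate \<open>x\<close> by \<open>- z\<close> with \<open>T z = y\<close>: the
      sets \<open>A\<close> and \<open>B\<close> trade places.\<close>
    also have "\<dots> = (\<integral>\<^sup>+x. (\<integral>\<^sup>+y. indicator A (T x) * indicator B (T x + y) \<partial>lborel) \<partial>lborel)"
    proof (rule nn_integral_cong)
      fix x
      show "(\<integral>\<^sup>+y. indicator A (T x) * indicator B y \<partial>lborel)
        = (\<integral>\<^sup>+y. indicator A (T x) * indicator B (T x + y) \<partial>lborel)"
        by (rule nn_integral_lborel_shift[symmetric, where f="\<lambda>y. indicator A (T x) * indicator B y"]) simp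
    qed
    also have "\<dots> = (\<integral>\<^sup>+y. (\<integral>\<^sup>+x. indicator A (T x) * indicator B (T x + y) \<partial>lborel) \<partial>lborel)"
      by (rule lborel_pair.Fubini') simp
    also have "\<dots> = (\<integral>\<^sup>+y. (\<integral>\<^sup>+x. indicator A (T x - y) * indicator B (T x) \<partial>lborel) \<partial>lborel)"
    proof (rule nn_integral_cong)
      fix y
      obtain z where z: "T z = y" using surj by (metis surjD)
      have "(\<integral>\<^sup>+x. indicator A (T x) * indicator B (T x + y) \<partial>lborel)
        = (\<integral>\<^sup>+x. indicator A (T (- z + x)) * indicator B (T (- z + x) + y) \<partial>lborel)"
        by (rule nn_integral_lborel_shift[symmetric, where f="\<lambda>x. indicator A (T x) * indicator B (T x + y)"]) simp
      moreover have "T (- z + x) = T x - y" for x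
        using linear_diff[OF T(1), of x z] by (simp add: z)
      ultimately show "(\<integral>\<^sup>+x. indicator A (T x) * indicator B (T x + y) \<partial>lborel)
        = (\<integral>\<^sup>+x. indicator A (T x - y) * indicator B (T x) \<partial>lborel)"
        by (simp only: diff_add_cancel)
    qed
    also have "\<dots> = (\<integral>\<^sup>+x. (\<integral>\<^sup>+y. indicator A (T x - y) * indicator B (T x) \<partial>lborel) \<partial>lborel)"
      by (rule lborel_pair.Fubini') simp
    also have "\<dots> = (\<integral>\<^sup>+x. (\<integral>\<^sup>+y. indicator A (- y) * indicator B x \<partial>lborel) \<partial>lborel)"
    proof (rule nn_integral_cong)
      fix x
      have "(\<integral>\<^sup>+y. indicator A (T x - (T x + y)) * indicator B (T x) \<partial>lborel)
        = (\<integral>\<^sup>+y. indicator A (T x - y) * indicator B (T x) \<partial>lborel)"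
        by (rule nn_integral_lborel_shift[where f="\<lambda>y. indicator A (T x - y) * indicator B (T x)"]) simp
      then show "(\<integral>\<^sup>+y. indicator A (T x - y) * indicator B (T x) \<partial>lborel)
        = (\<integral>\<^sup>+y. indicator A (- y) * indicator B x \<partial>lborel)"
        by (simp add: BT)
    qed
    also have "\<dots> = (\<integral>\<^sup>+y. indicator A (- y) \<partial>lborel) * (\<integral>\<^sup>+y. indicator B y \<partial>lborel)"
      by (simp add: nn_integral_cmult nn_integral_multc)
    finally show ?thesis
      unfolding B using B0 by (simp add: mult_right_ennreal_cancel)
  qed
  have [measurable]: "T \<in> borel_measurable borel"
    using T(1) by (intro borel_measurable_continuous_onI linear_continuous_on)
      (simp add: linear_conv_bounded_linear)
  show ?thesis
  proof (rule measure_eqI)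
    fix A assume "A \<in> sets (distr lborel borel T)"
    then have A[measurable]: "A \<in> sets borel" by simp
    have "emeasure lborel (T -` A) = emeasure lborel ((\<lambda>x. x) -` A)"
      using key[OF T A] key[OF linear_id[unfolded id_def] refl A] by simp
    then show "emeasure (distr lborel borel T) A = emeasure lborel A"
      by (simp add: emeasure_distr)
  qed simp
qed

lemma linear_isometry_integral:
  fixes T :: "'a::euclidean_space \<Rightarrow> 'a" and f :: "'a \<Rightarrow> 'b::{banach, second_countable_topology}"
  assumes T: "linear T" "\<And>x. norm (T x) = norm x" and [measurable]: "f \<in> borel_measurable borel"
  shows "(LINT x|lborel. f (T x)) = (LINT x|lborel. f x)"
proof -
  have [measurable]: "T \<in> borel_measurable borel"
    using T(1) by (intro borel_measurable_continuous_onI linear_continuous_on)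
      (simp add: linear_conv_bounded_linear)
  show ?thesis
    using integral_distr[of T lborel borel f] by (simp add: distr_lborel_isometry[OF T])
qed

section \<open>Integrals of negative powers by layer cake\<close>

lemma nn_integral_powr_atLeast:
  fixes r e :: real
  assumes "0 < r" "0 < e"
  shows "(\<integral>\<^sup>+t. ennreal (t powr (- e - 1)) * indicator {r..} t \<partial>lborel) = ennreal (r powr (- e) / e)"
  using nn_integral_has_integral_lebesgue'[OF _ has_integral_powr_to_inf[of "-e-1" r]] assms by simp

lemma nn_integral_powr_from_0:
  fixes e :: real
  assumes "0 < e"
  shows "(\<integral>\<^sup>+t. ennreal (t powr (e - 1)) * indicator {0..1} t \<partial>lborel) = ennreal (1 / e)"
  using nn_integral_has_integral_lebesgue'[OF _ has_integral_powr_from_0[of "e-1" 1]] assms by simp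

text \<open>
  Write \<open>r powr (- a)\<close> as the integral of \<open>a * t powr (- a - 1)\<close> over \<open>t \<ge> r\<close> and exchange the
  order of integration. Only an inequality is claimed because \<open>0 powr (- a) = 0\<close>.
\<close>

lemma nn_integral_powr_layer_cake:
  fixes \<rho> :: "'a::euclidean_space \<Rightarrow> real" and a :: real
  assumes [measurable]: "\<rho> \<in> borel_measurable borel" "A \<in> sets borel"
    and nonneg: "\<And>x. 0 \<le> \<rho> x" and a: "0 < a"
  shows "(\<integral>\<^sup>+x. ennreal (\<rho> x powr (- a)) * indicator A x \<partial>lborel)
    \<le> (\<integral>\<^sup>+t. ennreal (a * t powr (- a - 1)) * indicator {0<..} t
          * emeasure lborel {x \<in> A. \<rho> x \<le> t} \<partial>lborel)"
proof -
  \<comment> \<open>At \<open>\<rho> x = 0\<close> the left-hand side is \<open>0\<close>.\<close>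
  have pt: "ennreal (\<rho> x powr (- a))
      \<le> (\<integral>\<^sup>+t. ennreal (a * t powr (- a - 1)) * indicator {0<..} t * indicator {x. \<rho> x \<le> t} x \<partial>lborel)" for x
  proof (cases "\<rho> x = 0")
    case False
    then have r: "0 < \<rho> x" using nonneg[of x] by simp
    have "ennreal (\<rho> x powr (- a)) = ennreal a * ennreal (\<rho> x powr (- a) / a)"
      using a by (simp add: ennreal_mult'[symmetric])
    also have "\<dots> = (\<integral>\<^sup>+t. ennreal a * (ennreal (t powr (- a - 1)) * indicator {\<rho> x..} t) \<partial>lborel)"
      using nn_integral_powr_atLeast[OF r a] by (simp add: nn_integral_cmult)
    also have "\<dots> = (\<integral>\<^sup>+t. ennreal (a * t powr (- a - 1)) * indicator {0<..} t * indicator {x. \<rho> x \<le> t} x \<partial>lborel)"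
      using r a by (intro nn_integral_cong) (auto simp: indicator_def ennreal_mult')
    finally show ?thesis by simp
  qed simp
  have "(\<integral>\<^sup>+x. ennreal (\<rho> x powr (- a)) * indicator A x \<partial>lborel)
    \<le> (\<integral>\<^sup>+x. (\<integral>\<^sup>+t. ennreal (a * t powr (- a - 1)) * indicator {0<..} t * indicator {x. \<rho> x \<le> t} x \<partial>lborel)
        * indicator A x \<partial>lborel)"
    by (intro nn_integral_mono mult_right_mono pt) simp
  also have "\<dots> = (\<integral>\<^sup>+x. (\<integral>\<^sup>+t. ennreal (a * t powr (- a - 1)) * indicator {0<..} t
        * (if x \<in> A \<and> \<rho> x \<le> t then 1 else 0) \<partial>lborel) \<partial>lborel)"
    by (subst nn_integral_multc[symmetric]) (auto intro!: nn_integral_cong simp: indicator_def)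
  also have "\<dots> = (\<integral>\<^sup>+t. (\<integral>\<^sup>+x. ennreal (a * t powr (- a - 1)) * indicator {0<..} t
        * (if x \<in> A \<and> \<rho> x \<le> t then 1 else 0) \<partial>lborel) \<partial>lborel)"
    by (rule lborel_pair.Fubini') simp
  also have "\<dots> = (\<integral>\<^sup>+t. ennreal (a * t powr (- a - 1)) * indicator {0<..} t
          * emeasure lborel {x \<in> A. \<rho> x \<le> t} \<partial>lborel)"
  proof (rule nn_integral_cong)
    fix t
    have "(\<integral>\<^sup>+x. (if x \<in> A \<and> \<rho> x \<le> t then 1 else 0) \<partial>lborel) = emeasure lborel {x \<in> A. \<rho> x \<le> t}"
    proof -
      have [measurable]: "{x \<in> A. \<rho> x \<le> t} \<in> sets borel" by simp
      show ?thesis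
        using nn_integral_indicator[of "{x \<in> A. \<rho> x \<le> t}" lborel]
        by (simp add: indicator_def of_bool_def)
    qed
    then show "(\<integral>\<^sup>+x. ennreal (a * t powr (- a - 1)) * indicator {0<..} t
        * (if x \<in> A \<and> \<rho> x \<le> t then 1 else 0) \<partial>lborel)
      = ennreal (a * t powr (- a - 1)) * indicator {0<..} t * emeasure lborel {x \<in> A. \<rho> x \<le> t}"
      by (subst nn_integral_cmult) auto
  qed
  finally show ?thesis .
qed

lemma nn_integral_powr_tail_le:
  fixes r \<sigma> :: real
  assumes r: "0 < r" and \<sigma>: "0 < \<sigma>"
  shows "(\<integral>\<^sup>+(h::'a::euclidean_space). ennreal (norm h powr (- (real DIM('a) + \<sigma>))) * indicator {h. r \<le> norm h} h \<partial>lborel)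
    \<le> ennreal ((real DIM('a) + \<sigma>) * unit_ball_vol (real DIM('a)) / \<sigma> * r powr (- \<sigma>))"
proof -
  define a where "a = real DIM('a) + \<sigma>"
  define w where "w = unit_ball_vol (real DIM('a))"
  have w: "0 \<le> w" and a: "0 < a" using \<sigma> by (auto simp: w_def a_def)
  have "(\<integral>\<^sup>+(h::'a). ennreal (norm h powr (- a)) * indicator {h. r \<le> norm h} h \<partial>lborel)
    \<le> (\<integral>\<^sup>+t. ennreal (a * t powr (- a - 1)) * indicator {0<..} t
          * emeasure lborel {h\<in>{h::'a. r \<le> norm h}. norm h \<le> t} \<partial>lborel)"
    using a by (intro nn_integral_powr_layer_cake) auto
  also have "\<dots> \<le> (\<integral>\<^sup>+t. ennreal (a * w) * (ennreal (t powr (- \<sigma> - 1)) * indicator {r..} t) \<partial>lborel)"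
  proof (rule nn_integral_mono)
    fix t :: real
    show "ennreal (a * t powr (- a - 1)) * indicator {0<..} t
          * emeasure lborel {h\<in>{h::'a. r \<le> norm h}. norm h \<le> t}
        \<le> ennreal (a * w) * (ennreal (t powr (- \<sigma> - 1)) * indicator {r..} t)"
    proof (cases "r \<le> t")
      case True
      then have t: "0 < t" using r by simp
      have "emeasure lborel {h\<in>{h::'a. r \<le> norm h}. norm h \<le> t} \<le> emeasure lborel (cball (0::'a) t)"
        by (intro emeasure_mono) auto
      also have "\<dots> = ennreal (w * t ^ DIM('a))"
        using t by (simp add: emeasure_cball w_def)
      finally have "ennreal (a * t powr (- a - 1)) * emeasure lborel {h\<in>{h::'a. r \<le> norm h}. norm h \<le> t}
        \<le> ennreal (a * t powr (- a - 1)) * ennreal (w * t ^ DIM('a))"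
        by (rule mult_left_mono) simp
      also have "\<dots> = ennreal (a * w * t powr (- \<sigma> - 1))"
      proof -
        have "t powr (- a - 1) * t ^ DIM('a) = t powr (- a - 1) * t powr real DIM('a)"
          using t by (simp add: powr_realpow)
        also have "\<dots> = t powr (- \<sigma> - 1)"
          by (simp add: powr_add[symmetric] a_def)
        finally have "a * t powr (- a - 1) * (w * t ^ DIM('a)) = a * w * t powr (- \<sigma> - 1)"
          by (metis (no_types) mult.assoc mult.commute)
        then show ?thesis
          using a w by (simp only: ennreal_mult'[symmetric] powr_ge_zero mult_nonneg_nonneg less_imp_le)
      qed
      finally show ?thesis
        using True t a w by (simp add: ennreal_mult' mult_ac)
    next
      case False
      then have e: "{h\<in>{h::'a. r \<le> norm h}. norm h \<le> t} = {}" by auto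
      show ?thesis unfolding e by simp
    qed
  qed
  also have "\<dots> = ennreal (a * w) * ennreal (r powr (- \<sigma>) / \<sigma>)"
    by (simp add: nn_integral_cmult nn_integral_powr_atLeast[OF r \<sigma>])
  also have "\<dots> = ennreal (a * w / \<sigma> * r powr (- \<sigma>))"
    using a w \<sigma> by (simp add: ennreal_mult'[symmetric])
  finally show ?thesis by (simp add: a_def w_def)
qed

text \<open>
  In the layer cake formula the integral of \<open>t powr (\<alpha> - a - 1)\<close> converges at \<open>0\<close> as \<open>a < \<alpha>\<close>.
  A function \<open>\<rho>\<close> with sublevel sets of measure \<open>O(t powr \<alpha>)\<close> behaves like the distance to a set of
  codimension \<open>\<alpha>\<close>. It is used with the distance to a point (\<open>\<alpha>\<close> the dimension) and with the
  distance to a sphere (\<open>\<alpha> = 1\<close>).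
\<close>

lemma nn_integral_powr_near_finite:
  fixes \<rho> :: "'a::euclidean_space \<Rightarrow> real" and a \<alpha> C :: real
  assumes [measurable]: "\<rho> \<in> borel_measurable borel" "A \<in> sets borel"
    and nonneg: "\<And>x. 0 \<le> \<rho> x" and a: "0 < a" "a < \<alpha>" and C: "0 \<le> C"
    and A: "\<And>x. x \<in> A \<Longrightarrow> \<rho> x \<le> 1"
    and le: "\<And>t. 0 < t \<Longrightarrow> t \<le> 1 \<Longrightarrow> emeasure lborel {x \<in> A. \<rho> x \<le> t} \<le> ennreal (C * t powr \<alpha>)"
  shows "(\<integral>\<^sup>+x. ennreal (\<rho> x powr (- a)) * indicator A x \<partial>lborel) < \<infinity>"
proof -
  have "(\<integral>\<^sup>+x. ennreal (\<rho> x powr (- a)) * indicator A x \<partial>lborel)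
    \<le> (\<integral>\<^sup>+t. ennreal (a * t powr (- a - 1)) * indicator {0<..} t
          * emeasure lborel {x \<in> A. \<rho> x \<le> t} \<partial>lborel)"
    by (intro nn_integral_powr_layer_cake nonneg a) auto
  also have "\<dots> \<le> (\<integral>\<^sup>+t. ennreal (a * C) * (ennreal (t powr ((\<alpha> - a) - 1)) * indicator {0..1} t)
      + ennreal (a * C) * (ennreal (t powr (- a - 1)) * indicator {1..} t) \<partial>lborel)"
  proof (rule nn_integral_mono)
    fix t :: real
    consider "t \<le> 0" | "0 < t" "t \<le> 1" | "1 < t" by linarith
    then show "ennreal (a * t powr (- a - 1)) * indicator {0<..} t * emeasure lborel {x \<in> A. \<rho> x \<le> t}
        \<le> ennreal (a * C) * (ennreal (t powr ((\<alpha> - a) - 1)) * indicator {0..1} t)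
      + ennreal (a * C) * (ennreal (t powr (- a - 1)) * indicator {1..} t)"
    proof cases
      case 2
      have "ennreal (a * t powr (- a - 1)) * emeasure lborel {x \<in> A. \<rho> x \<le> t}
        \<le> ennreal (a * t powr (- a - 1)) * ennreal (C * t powr \<alpha>)"
        by (intro mult_left_mono le 2) simp
      also have "\<dots> = ennreal (a * C) * ennreal (t powr ((\<alpha> - a) - 1))"
      proof -
        have "t powr (- a - 1) * t powr \<alpha> = t powr ((\<alpha> - a) - 1)"
          by (simp add: powr_add[symmetric] algebra_simps)
        then show ?thesis using a C by (simp add: ennreal_mult'[symmetric] mult_ac)
      qed
      finally show ?thesis using 2 by (simp add: add_increasing2)
    next
      case 3
      have "{x \<in> A. \<rho> x \<le> t} \<subseteq> {x \<in> A. \<rho> x \<le> 1}" using A by auto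
      then have "emeasure lborel {x \<in> A. \<rho> x \<le> t} \<le> emeasure lborel {x \<in> A. \<rho> x \<le> 1}"
        by (intro emeasure_mono) auto
      also have "\<dots> \<le> ennreal C" using le[of 1] by simp
      finally have "ennreal (a * t powr (- a - 1)) * emeasure lborel {x \<in> A. \<rho> x \<le> t}
        \<le> ennreal (a * t powr (- a - 1)) * ennreal C"
        by (intro mult_left_mono) auto
      then show ?thesis using 3 a C by (simp add: ennreal_mult'[symmetric] mult_ac)
    qed simp
  qed
  also have "\<dots> = ennreal (a * C) * ennreal (1 / (\<alpha> - a)) + ennreal (a * C) * ennreal (1 / a)"
    using a nn_integral_powr_from_0[of "\<alpha> - a"] nn_integral_powr_atLeast[of 1 a]
    by (subst nn_integral_add) (auto simp: nn_integral_cmult)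
  also have "\<dots> < \<infinity>" by (simp add: ennreal_mult_less_top)
  finally show ?thesis .
qed

section \<open>Smooth test fields\<close>

lemma Ck_Suc_D: "Ck (Suc k) f \<Longrightarrow> Ck k f"
proof (induction k arbitrary: f)
  case 0
  then show ?case
    by (simp add: continuous_at_imp_continuous_on differentiable_imp_continuous_within)
next
  case (Suc k)
  then show ?case by (simp del: Ck.simps(2) add: Ck.simps(2)[of "Suc k" f] Ck.simps(2)[of k f])
qed

lemma frechet_derivative_eq: "(f has_derivative f') (at x) \<Longrightarrow> frechet_derivative f (at x) = f'"
  using frechet_derivative_at[of f f' x] by simp

lemma Ck_add: "Ck k f \<Longrightarrow> Ck k g \<Longrightarrow> Ck k (\<lambda>x. f x + g x)"
proof (induction k arbitrary: f g)
  case 0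
  then show ?case by (simp add: continuous_on_add)
next
  case (Suc k)
  have D: "((\<lambda>x. f x + g x) has_derivative (\<lambda>v. frechet_derivative f (at x) v + frechet_derivative g (at x) v)) (at x)" for x
    using Suc.prems by (intro has_derivative_add) (simp_all add: frechet_derivative_works[symmetric])
  then show ?case
    using Suc D by (auto simp: frechet_derivative_eq[OF D] differentiable_def)
qed

lemma Ck_const: "Ck k (\<lambda>x. c)"
  by (induction k arbitrary: c) auto

lemma Ck_scaleR: "Ck k f \<Longrightarrow> Ck k g \<Longrightarrow> Ck k (\<lambda>x. f x *\<^sub>R g x)"
proof (induction k arbitrary: f g)
  case 0
  then show ?case by (simp add: continuous_on_scaleR)
next
  case (Suc k)
  have D: "((\<lambda>x. f x *\<^sub>R g x) has_derivative
      (\<lambda>v. f x *\<^sub>R frechet_derivative g (at x) v + frechet_derivative f (at x) v *\<^sub>R g x)) (at x)" for x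
    using Suc.prems by (intro has_derivative_scaleR) (simp_all add: frechet_derivative_works[symmetric])
  then show ?case
    using Suc D Ck_Suc_D[OF Suc.prems(1)] Ck_Suc_D[OF Suc.prems(2)]
    by (auto simp: frechet_derivative_eq[OF D] differentiable_def intro!: Ck_add)
qed

lemma Ck_prod:
  fixes f :: "'i \<Rightarrow> 'a::euclidean_space \<Rightarrow> real"
  assumes "\<And>i. i \<in> I \<Longrightarrow> Ck k (f i)"
  shows "Ck k (\<lambda>x. \<Prod>i\<in>I. f i x)"
  using assms
proof (induction I rule: infinite_finite_induct)
  case (insert i I)
  then show ?case using Ck_scaleR[of k "f i" "\<lambda>x. \<Prod>i\<in>I. f i x"] by simp
qed (auto intro: Ck_const)

text \<open>
  The factors \<open>1 / t ^ m\<close> make the family closed under differentiation, so that smoothness of all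
  its members follows from a single induction on the order of the derivative.
\<close>

definition flat_exp :: "nat \<Rightarrow> real \<Rightarrow> real" where
  "flat_exp m t = (if 0 < t then exp (- 1 / t) / t ^ m else 0)"

lemma flat_exp_tendsto_0: "(flat_exp m \<longlongrightarrow> 0) (at 0)"
proof (rule filterlim_split_at)
  have "eventually (\<lambda>t. flat_exp m t = 0) (at_left 0)"
    by (auto simp: flat_exp_def eventually_at_filter)
  then show "(flat_exp m \<longlongrightarrow> 0) (at_left 0)"
    by (rule tendsto_eventually)
  have "((\<lambda>t. inverse t ^ m / exp (inverse t)) \<longlongrightarrow> 0) (at_right (0::real))"
    by (rule filterlim_compose[OF tendsto_power_div_exp_0 filterlim_inverse_at_top_right])
  moreover have "eventually (\<lambda>t. inverse t ^ m / exp (inverse t) = flat_exp m t) (at_right 0)"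
    by (auto simp: flat_exp_def eventually_at_filter exp_minus field_simps)
  ultimately show "(flat_exp m \<longlongrightarrow> 0) (at_right 0)"
    by (rule Lim_transform_eventually)
qed

lemma flat_exp_DERIV:
  "(flat_exp m has_real_derivative (flat_exp (m + 2) t - real m * flat_exp (m + 1) t)) (at t)"
proof -
  consider "t < 0" | "t = 0" | "0 < t" by linarith
  then show ?thesis
  proof cases
    case 1
    have "(flat_exp m has_real_derivative 0) (at t)"
      by (rule has_field_derivative_transform_within_open[of "\<lambda>_. 0" 0 t "{..<0}"])
        (use 1 in \<open>auto simp: flat_exp_def\<close>)
    then show ?thesis using 1 by (simp add: flat_exp_def)
  next
    case 2
    have "((\<lambda>h. (flat_exp m (0 + h) - flat_exp m 0) / h) \<longlongrightarrow> 0) (at 0)"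
    proof (rule Lim_transform_eventually[OF flat_exp_tendsto_0[of "Suc m"]])
      show "eventually (\<lambda>h. flat_exp (Suc m) h = (flat_exp m (0 + h) - flat_exp m 0) / h) (at 0)"
        by (auto simp: flat_exp_def eventually_at_filter field_simps)
    qed
    then have "(flat_exp m has_real_derivative 0) (at 0)"
      by (simp add: DERIV_def)
    then show ?thesis using 2 by (simp add: flat_exp_def)
  next
    case 3
    have "((\<lambda>t. exp (- 1 / t) / t ^ m) has_real_derivative
        (flat_exp (m + 2) t - real m * flat_exp (m + 1) t)) (at t)"
      using 3 by (auto intro!: derivative_eq_intros simp: flat_exp_def field_simps power2_eq_square
          power_diff split: nat_diff_split)
    then show ?thesis
      by (rule has_field_derivative_transform_within_open[of _ _ t "{0<..}"])
        (use 3 in \<open>auto simp: flat_exp_def\<close>)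
  qed
qed

lemma Ck_flat_exp:
  fixes l :: "'a::euclidean_space \<Rightarrow> real"
  assumes l: "\<And>x. (l has_derivative l') (at x)"
  shows "Ck k (\<lambda>x. flat_exp m (l x))"
proof (induction k arbitrary: m)
  case 0
  have "isCont (\<lambda>x. flat_exp m (l x)) x" for x
    using has_derivative_continuous[OF l] DERIV_isCont[OF flat_exp_DERIV]
    by (rule isCont_o2)
  then show ?case by (simp add: continuous_at_imp_continuous_on)
next
  case (Suc k)
  have D: "((\<lambda>x. flat_exp m (l x)) has_derivative
      (\<lambda>v. l' v * (flat_exp (m + 2) (l x) + (- real m) * flat_exp (m + 1) (l x)))) (at x)" for x
    by (rule DERIV_compose_FDERIV[OF _ l, THEN has_derivative_eq_rhs])
      (use flat_exp_DERIV in \<open>auto simp: fun_eq_iff\<close>)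
  have "Ck k (\<lambda>x. l' v *\<^sub>R (flat_exp (m + 2) (l x) + (- real m) *\<^sub>R flat_exp (m + 1) (l x)))" for v
    by (intro Ck_scaleR Ck_add Ck_const Suc.IH)
  then show ?case
    using D by (auto simp: frechet_derivative_eq[OF D] differentiable_def)
qed

lemma continuous_compact_support_bounded:
  fixes f :: "'a::euclidean_space \<Rightarrow> 'b::real_normed_vector"
  assumes "continuous_on UNIV f" "compact K" "\<And>x. x \<notin> K \<Longrightarrow> f x = 0"
  shows "\<exists>M. \<forall>x. norm (f x) \<le> M"
proof -
  have "bounded (f ` K)"
    using assms continuous_on_subset by (blast intro: compact_imp_bounded compact_continuous_image)
  then obtain M where "\<forall>x\<in>K. norm (f x) \<le> M" by (auto simp: bounded_iff)
  then have "norm (f x) \<le> max M 0" for x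
    using assms(3)[of x] by (cases "x \<in> K") (auto simp: le_max_iff_disj)
  then show ?thesis by blast
qed

text \<open>
  The partial derivatives are continuous with compact support, hence bounded, and the mean value
  theorem applies.
\<close>

lemma test_field_bounded_lipschitz:
  fixes \<phi> :: "'a::euclidean_space \<Rightarrow> 'a"
  assumes "test_field \<phi>"
  shows "continuous_on UNIV \<phi>" "\<exists>M. \<forall>x. norm (\<phi> x) \<le> M"
    "\<exists>L. \<forall>x y. norm (\<phi> y - \<phi> x) \<le> L * norm (y - x)"
proof -
  define K where "K = closure {x. \<phi> x \<noteq> 0}"
  have K: "compact K" and C: "Ck k \<phi>" for k
    using assms by (auto simp: test_field_def K_def)
  have out: "\<phi> x = 0" if "x \<notin> K" for x
    using that closure_subset[of "{x. \<phi> x \<noteq> 0}"] by (auto simp: K_def)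
  show cont: "continuous_on UNIV \<phi>" using C[of 0] by simp
  show "\<exists>M. \<forall>x. norm (\<phi> x) \<le> M"
    by (rule continuous_compact_support_bounded[OF cont K out])
  define D where "D x = frechet_derivative \<phi> (at x)" for x
  have D: "(\<phi> has_derivative D x) (at x)" for x
    using C[of 1] by (simp add: D_def frechet_derivative_works[symmetric])
  have Dout: "D x v = 0" if "x \<notin> K" for x v
  proof -
    have "(\<phi> has_derivative (\<lambda>_. 0)) (at x)"
      by (rule has_derivative_transform_within_open[of "\<lambda>_. 0" _ _ _ "- K"])
        (use that out K in \<open>auto simp: compact_imp_closed open_Compl\<close>)
    then show ?thesis using has_derivative_unique[OF D] by metis
  qed
  have "\<exists>M. \<forall>x. norm (D x b) \<le> M" for b
  proof (rule continuous_compact_support_bounded[OF _ K Dout])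
    show "continuous_on UNIV (\<lambda>x. D x b)" using C[of 1] by (simp add: D_def)
  qed
  then obtain M where M: "\<And>x b. norm (D x b) \<le> M b" by metis
  define L where "L = (\<Sum>b\<in>Basis. M b)"
  have "norm (D x v) \<le> L * norm v" for x v
  proof -
    have lin: "linear (D x)" using D[of x] by (rule has_derivative_linear)
    have "D x v = D x (\<Sum>b\<in>Basis. (v \<bullet> b) *\<^sub>R b)" by (simp add: euclidean_representation)
    also have "\<dots> = (\<Sum>b\<in>Basis. (v \<bullet> b) *\<^sub>R D x b)"
      by (simp add: linear_sum[OF lin] linear_scale[OF lin])
    also have "norm \<dots> \<le> (\<Sum>b\<in>Basis. norm v * M b)"
      by (intro sum_norm_le) (auto intro!: mult_mono M simp: Basis_le_norm)
    finally show ?thesis by (simp add: L_def sum_distrib_left mult.commute)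
  qed
  then have "norm (\<phi> y - \<phi> x) \<le> L * norm (y - x)" for x y
    using differentiable_bound[of UNIV \<phi> D L y x] D
    by (auto intro!: onorm_le)
  then show "\<exists>L. \<forall>x y. norm (\<phi> y - \<phi> x) \<le> L * norm (y - x)" by blast
qed

text \<open>
  For \<open>n > 0\<close> each factor is positive exactly on a half-space, so the product lives on a box; as
  \<open>flat_exp 0 (n * t)\<close> tends to the step function of \<open>t\<close>, the scaling by \<open>n\<close> gives pointwise
  convergence to the indicator of the open box.
\<close>

definition box_bump :: "'a::euclidean_space \<Rightarrow> 'a \<Rightarrow> nat \<Rightarrow> 'a \<Rightarrow> real" where
  "box_bump a b n x = (\<Prod>i\<in>Basis. flat_exp 0 (real n * (x \<bullet> i - a \<bullet> i)) * flat_exp 0 (real n * (b \<bullet> i - x \<bullet> i)))"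

lemma flat_exp_0_bounds: "0 \<le> flat_exp 0 t" "flat_exp 0 t \<le> 1"
  by (auto simp: flat_exp_def)

lemma flat_exp_0_tendsto_step:
  "(\<lambda>n. flat_exp 0 (real n * t)) \<longlonglongrightarrow> of_bool (0 < t)"
proof (cases "0 < t")
  case True
  have "(\<lambda>n. exp (- (1 / t) * (1 / real n))) \<longlonglongrightarrow> exp (- (1 / t) * 0)"
    by (intro tendsto_intros lim_1_over_n)
  moreover have "eventually (\<lambda>n. exp (- (1 / t) * (1 / real n)) = flat_exp 0 (real n * t)) sequentially"
    using eventually_gt_at_top[of 0] by eventually_elim (use True in \<open>auto simp: flat_exp_def mult.commute\<close>)
  ultimately show ?thesis using True by (simp add: Lim_transform_eventually)
next
  case False
  then show ?thesis by (simp add: flat_exp_def zero_less_mult_iff)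
qed

lemma box_bump_bounds: "0 \<le> box_bump a b n x" "box_bump a b n x \<le> 1"
  by (auto simp: box_bump_def intro!: prod_nonneg prod_le_1 mult_le_one flat_exp_0_bounds mult_nonneg_nonneg)

lemma box_bump_tendsto_indicator: "(\<lambda>n. box_bump a b n x) \<longlonglongrightarrow> indicat_real (box a b) x"
proof -
  have "(\<lambda>n. box_bump a b n x) \<longlonglongrightarrow> (\<Prod>i\<in>Basis. of_bool (0 < x \<bullet> i - a \<bullet> i) * of_bool (0 < b \<bullet> i - x \<bullet> i))"
    unfolding box_bump_def by (intro tendsto_prod tendsto_mult flat_exp_0_tendsto_step)
  also have "(\<Prod>i\<in>Basis. of_bool (0 < x \<bullet> i - a \<bullet> i) * of_bool (0 < b \<bullet> i - x \<bullet> i)) = indicat_real (box a b) x"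
    by (auto simp: indicator_def box_def prod_eq_1_iff intro!: prod.neutral)
  finally show ?thesis .
qed

lemma test_field_box_bump: "test_field (\<lambda>x. box_bump a b n x *\<^sub>R (v::'a::euclidean_space))"
proof -
  have "Ck k (box_bump a b n)" for k
  proof -
    have "Ck k (\<lambda>x. \<Prod>i\<in>Basis. flat_exp 0 (real n * (x \<bullet> i - a \<bullet> i)) *\<^sub>R flat_exp 0 (real n * (b \<bullet> i - x \<bullet> i)))"
      by (intro Ck_prod Ck_scaleR Ck_flat_exp) (auto intro!: derivative_eq_intros)
    then show ?thesis by (simp add: box_bump_def[abs_def])
  qed
  then have "Ck k (\<lambda>x. box_bump a b n x *\<^sub>R v)" for k
    by (intro Ck_scaleR Ck_const)
  moreover have "{x. box_bump a b n x *\<^sub>R v \<noteq> 0} \<subseteq> cbox a b"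
    by (auto simp: box_bump_def flat_exp_def cbox_def zero_less_mult_iff split: if_splits)
  then have "bounded {x. box_bump a b n x *\<^sub>R v \<noteq> 0}"
    using bounded_cbox bounded_subset by blast
  ultimately show ?thesis
    by (simp add: test_field_def)
qed

text \<open>
  Boxes form an intersection-stable generator of the Borel sets and exhaust the space, so the
  integral over every Borel set vanishes.
\<close>

lemma AE_zero_if_box_integrals_zero:
  fixes f :: "'a::euclidean_space \<Rightarrow> real"
  assumes f: "integrable lborel f"
    and box: "\<And>a b. (LINT x:box a b|lborel. f x) = 0"
  shows "AE x in lborel. f x = 0"
proof (rule sigma_finite_measure.density_zero[OF sigma_finite_lborel f])
  have [measurable]: "f \<in> borel_measurable borel" using f by simp
  have sint: "set_integrable lborel A f" if "A \<in> sets borel" for A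
    unfolding set_integrable_def using f that by (intro integrable_mult_indicator) auto
  have UNIV: "(LINT x|lborel. f x) = 0"
  proof -
    let ?B = "\<lambda>i::nat. box (- (real i *\<^sub>R One)) (real i *\<^sub>R One) :: 'a set"
    have "(\<lambda>i. LINT x|lborel. indicat_real (?B i) x * f x) \<longlonglongrightarrow> (LINT x|lborel. f x)"
    proof (rule integral_dominated_convergence[where w = "\<lambda>x. norm (f x)"])
      show "AE x in lborel. (\<lambda>i. indicat_real (?B i) x * f x) \<longlonglongrightarrow> f x"
      proof (rule AE_I2)
        fix x :: 'a
        obtain i where i: "x \<in> ?B i" using UN_box_eq_UNIV by blast
        have "x \<in> ?B j" if "i \<le> j" for j
        proof -
          have "?B i \<subseteq> ?B j" using that by (intro subset_box_imp) auto
          then show ?thesis using i by blast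
        qed
        then have "eventually (\<lambda>j. indicat_real (?B j) x * f x = f x) sequentially"
          by (auto simp: eventually_sequentially intro!: exI[of _ i])
        then show "(\<lambda>i. indicat_real (?B i) x * f x) \<longlonglongrightarrow> f x" by (rule tendsto_eventually)
      qed
    qed (use f in \<open>auto intro!: AE_I2 simp: indicator_def\<close>)
    moreover have "(LINT x|lborel. indicat_real (?B i) x * f x) = 0" for i
      using box[of "- (real i *\<^sub>R One)" "real i *\<^sub>R One"] by (simp add: set_lebesgue_integral_def)
    ultimately show ?thesis by (simp add: LIMSEQ_const_iff)
  qed
  fix A :: "'a set" assume "A \<in> sets lborel"
  then have A: "A \<in> sigma_sets UNIV (range (\<lambda>(a, b). box a b))"
    by (simp add: borel_eq_box)
  have "Int_stable (range (\<lambda>(a, b). box a b :: 'a set))"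
    by (auto simp: Int_stable_def box_Int_box)
  moreover have "range (\<lambda>(a, b). box a b :: 'a set) \<subseteq> Pow UNIV" by simp
  ultimately show "(LINT x:A|lborel. f x) = 0"
    using A
  proof (induction rule: sigma_sets_induct_disjoint)
    case (basic A)
    then show ?case using box by auto
  next
    case empty
    show ?case by (simp add: set_lebesgue_integral_def)
  next
    case (compl A)
    then have [measurable]: "A \<in> sets borel" by (simp add: borel_eq_box)
    have "(LINT x:A \<union> (UNIV - A)|lborel. f x) = (LINT x:A|lborel. f x) + (LINT x:UNIV - A|lborel. f x)"
      by (intro set_integral_Un sint) auto
    then show ?case using compl UNIV by (simp add: set_lebesgue_integral_def)
  next
    case (union F)
    then have F: "F i \<in> sets borel" for i by (auto simp: borel_eq_box)
    then have "(LINT x:(\<Union>i. F i)|lborel. f x) = (\<Sum>i. (LINT x:(F i)|lborel. f x))"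
      using union by (intro lebesgue_integral_countable_add sint) (auto simp: disjoint_family_on_def)
    then show ?case using union by simp
  qed
qed

lemma AE_zero_if_orthogonal_to_test_fields:
  fixes g :: "'a::euclidean_space \<Rightarrow> 'a"
  assumes g: "integrable lborel g"
    and orth: "\<And>\<phi>. test_field \<phi> \<Longrightarrow> (LINT x|lborel. \<phi> x \<bullet> g x) = 0"
  shows "AE x in lborel. g x = 0"
proof -
  have [measurable]: "g \<in> borel_measurable borel" using g by simp
  have "AE x in lborel. g x \<bullet> v = 0" for v
  proof (rule AE_zero_if_box_integrals_zero)
    show gv: "integrable lborel (\<lambda>x. g x \<bullet> v)" using g by simp
    fix a b :: 'a
    have [measurable]: "box_bump a b n \<in> borel_measurable borel" for n
      unfolding box_bump_def[abs_def] flat_exp_def[abs_def] by measurable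
    have "(\<lambda>n. LINT x|lborel. box_bump a b n x * (g x \<bullet> v)) \<longlonglongrightarrow> (LINT x|lborel. indicat_real (box a b) x * (g x \<bullet> v))"
    proof (rule integral_dominated_convergence[where w = "\<lambda>x. norm (g x \<bullet> v)"])
      show "AE x in lborel. (\<lambda>n. box_bump a b n x * (g x \<bullet> v)) \<longlonglongrightarrow> indicat_real (box a b) x * (g x \<bullet> v)"
        by (intro AE_I2 tendsto_mult box_bump_tendsto_indicator tendsto_const)
      show "AE x in lborel. norm (box_bump a b n x * (g x \<bullet> v)) \<le> norm (g x \<bullet> v)" for n
        using box_bump_bounds[of a b n] by (intro AE_I2) (simp add: abs_mult mult_left_le_one_le)
    qed (use gv in \<open>auto\<close>)
    moreover have "(LINT x|lborel. box_bump a b n x * (g x \<bullet> v)) = 0" for n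
      using orth[OF test_field_box_bump[of a b n v]] by (simp add: inner_commute)
    ultimately show "(LINT x:box a b|lborel. g x \<bullet> v) = 0"
      by (simp add: LIMSEQ_const_iff set_lebesgue_integral_def)
  qed
  then have "AE x in lborel. \<forall>v\<in>Basis. g x \<bullet> v = 0"
    by (intro AE_finite_allI) auto
  then show ?thesis by eventually_elim (simp add: euclidean_all_zero_iff)
qed

section \<open>The fractional gradient as a singular integral\<close>

definition riesz_kernel :: "real \<Rightarrow> 'a::euclidean_space \<Rightarrow> 'a" where
  "riesz_kernel s h = h /\<^sub>R norm h powr (real DIM('a) + s + 1)"

definition riesz_grad :: "real \<Rightarrow> real \<Rightarrow> ('a::euclidean_space \<Rightarrow> real) \<Rightarrow> 'a \<Rightarrow> 'a" where
  "riesz_grad c s u x = c *\<^sub>R (LINT y|lborel. (u y - u x) *\<^sub>R riesz_kernel s (y - x))"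

text \<open>
  Since the kernel has norm \<open>|h| powr (- N - s)\<close>, this says that the Gagliardo seminorm of \<open>u\<close> in
  \<open>W\<^sup>s\<^sup>,\<^sup>1\<close> is finite. The vector-valued form allows Fubini's theorem to be applied directly to the
  integrand of the gradient.
\<close>

definition gagliardo_integrable :: "real \<Rightarrow> ('a::euclidean_space \<Rightarrow> real) \<Rightarrow> bool" where
  "gagliardo_integrable s u \<longleftrightarrow>
    integrable (lborel \<Otimes>\<^sub>M lborel) (\<lambda>z. (u (snd z) - u (fst z)) *\<^sub>R riesz_kernel s (snd z - fst z))"

lemma riesz_kernel_measurable [measurable]: "riesz_kernel s \<in> borel_measurable borel"
  unfolding riesz_kernel_def[abs_def] by measurable

lemma riesz_kernel_minus: "riesz_kernel s (- h) = - riesz_kernel s h"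
  by (simp add: riesz_kernel_def)

lemma norm_riesz_kernel:
  "norm (riesz_kernel s (h::'a::euclidean_space)) = norm h powr (- (real DIM('a) + s))"
proof (cases "h = 0")
  case False
  then have "norm h powr (real DIM('a) + s + 1) = norm h * norm h powr (real DIM('a) + s)"
    by (simp add: powr_add)
  moreover have "norm h powr (- (real DIM('a) + s)) = inverse (norm h powr (real DIM('a) + s))"
    by (rule powr_minus)
  ultimately show ?thesis using False by (simp only: riesz_kernel_def) simp
qed (simp add: riesz_kernel_def)

lemma frac_div_eq:
  "frac_div c s \<phi> x = c * (LINT y|lborel. (\<phi> y - \<phi> x) \<bullet> riesz_kernel s (y - x))"
  by (simp add: frac_div_def riesz_kernel_def divide_inverse mult.commute)

text \<open>
  This dominates \<open>(\<phi> (x + h) - \<phi> x) \<bullet> k h\<close> for bounded Lipschitz \<open>\<phi>\<close>: the Lipschitz bound gains one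
  power of \<open>|h|\<close> at the origin, which suffices as \<open>s < 1\<close>, and boundedness suffices at infinity as
  \<open>s > 0\<close>.
\<close>

lemma integrable_truncated_kernel:
  fixes s L M :: real
  assumes s: "0 < s" "s < 1" and L: "0 \<le> L" and M: "0 \<le> M"
  shows "integrable lborel (\<lambda>h::'a::euclidean_space. min (L * norm h) M * norm (riesz_kernel s h))"
proof (rule integrableI_bounded)
  have [measurable]: "{h::'a. 1 \<le> norm h} \<in> sets borel" "cball (0::'a) 1 \<in> sets borel" by simp_all
  have lin: "(\<integral>\<^sup>+h. ennreal L * f h + ennreal M * g h \<partial>lborel)
      = ennreal L * (\<integral>\<^sup>+h. f h \<partial>lborel) + ennreal M * (\<integral>\<^sup>+h. g h \<partial>lborel)"
    if [measurable]: "f \<in> borel_measurable borel" "g \<in> borel_measurable borel" for f g :: "'a \<Rightarrow> ennreal"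
    by (simp add: nn_integral_add nn_integral_cmult)
  define N where "N = real DIM('a)"
  have N: "1 \<le> N" using DIM_ge_Suc0[where 'a='a] by (simp add: N_def)
  have "(\<integral>\<^sup>+h. norm (min (L * norm h) M * norm (riesz_kernel s (h::'a))) \<partial>lborel)
    \<le> (\<integral>\<^sup>+h. ennreal L * (ennreal (norm (h::'a) powr (- (N + s - 1))) * indicator (cball 0 1) h)
        + ennreal M * (ennreal (norm h powr (- (N + s))) * indicator {h. 1 \<le> norm h} h) \<partial>lborel)"
  proof (rule nn_integral_mono)
    fix h :: 'a
    show "ennreal (norm (min (L * norm h) M * norm (riesz_kernel s h)))
      \<le> ennreal L * (ennreal (norm h powr (- (N + s - 1))) * indicator (cball 0 1) h)
        + ennreal M * (ennreal (norm h powr (- (N + s))) * indicator {h. 1 \<le> norm h} h)"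
    proof (cases "norm h \<le> 1")
      case True
      have "norm h * norm h powr (- (N + s)) = norm h powr (- (N + s - 1))" if "h \<noteq> 0"
        using that powr_add[of "norm h" 1 "- (N + s)"] by (simp add: algebra_simps)
      then have "norm h * norm (riesz_kernel s h) = norm h powr (- (N + s - 1))"
        by (cases "h = 0") (auto simp: norm_riesz_kernel N_def)
      moreover have "min (L * norm h) M * norm (riesz_kernel s h) \<le> L * norm h * norm (riesz_kernel s h)"
        by (intro mult_right_mono) auto
      ultimately have "min (L * norm h) M * norm (riesz_kernel s h) \<le> L * norm h powr (- (N + s - 1))"
        by (simp add: mult.assoc)
      then have "ennreal (min (L * norm h) M * norm (riesz_kernel s h)) \<le> ennreal L * ennreal (norm h powr (- (N + s - 1)))"
        using L by (simp add: ennreal_mult'[symmetric] ennreal_leI)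
      then show ?thesis using True L M by (simp add: add_increasing2)
    next
      case False
      have "min (L * norm h) M * norm (riesz_kernel s h) \<le> M * norm h powr (- (N + s))"
        by (simp add: norm_riesz_kernel N_def mult_right_mono)
      then have "ennreal (min (L * norm h) M * norm (riesz_kernel s h)) \<le> ennreal M * ennreal (norm h powr (- (N + s)))"
        using M by (simp add: ennreal_mult'[symmetric] ennreal_leI)
      then show ?thesis using False L M by simp
    qed
  qed
  also have "\<dots> = ennreal L * (\<integral>\<^sup>+h. ennreal (norm (h::'a) powr (- (N + s - 1))) * indicator (cball 0 1) h \<partial>lborel)
      + ennreal M * (\<integral>\<^sup>+h. ennreal (norm (h::'a) powr (- (N + s))) * indicator {h. 1 \<le> norm h} h \<partial>lborel)"
    by (rule lin; measurable)
  also have "\<dots> < \<infinity>"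
  proof -
    have "(\<integral>\<^sup>+h. ennreal (norm (h::'a) powr (- (N + s - 1))) * indicator (cball 0 1) h \<partial>lborel) < \<infinity>"
    proof (rule nn_integral_powr_near_finite[where \<alpha> = N and C = "unit_ball_vol N"])
      fix t :: real assume t: "0 < t" "t \<le> 1"
      then have "{x \<in> cball (0::'a) 1. norm x \<le> t} = cball 0 t" by auto
      then show "emeasure lborel {x \<in> cball (0::'a) 1. norm x \<le> t} \<le> ennreal (unit_ball_vol N * t powr N)"
        using t by (simp add: emeasure_cball N_def powr_realpow)
    qed (use s N in auto)
    moreover have "(\<integral>\<^sup>+h. ennreal (norm (h::'a) powr (- (N + s))) * indicator {h. 1 \<le> norm h} h \<partial>lborel) < \<infinity>"
      using nn_integral_powr_tail_le[of 1 s, where 'a='a] s unfolding N_def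
      by (simp add: order_le_less_trans)
    ultimately show ?thesis by (simp add: ennreal_mult_less_top)
  qed
  finally show "(\<integral>\<^sup>+h. norm (min (L * norm h) M * norm (riesz_kernel s (h::'a))) \<partial>lborel) < \<infinity>" .
qed simp

lemma integrable_mult_difference:
  fixes u m :: "'a::euclidean_space \<Rightarrow> real"
  assumes u: "integrable lborel u" and m: "integrable lborel m"
  shows "integrable (lborel \<Otimes>\<^sub>M lborel) (\<lambda>z. u (fst z) * m (snd z - fst z))"
proof (rule integrableI_bounded)
  have [measurable]: "u \<in> borel_measurable borel" "m \<in> borel_measurable borel" using u m by auto
  show "(\<lambda>z. u (fst z) * m (snd z - fst z)) \<in> borel_measurable (lborel \<Otimes>\<^sub>M lborel)" by measurable
  have "(\<integral>\<^sup>+z. ennreal (norm (u (fst z) * m (snd z - fst z))) \<partial>(lborel \<Otimes>\<^sub>M lborel))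
    = (\<integral>\<^sup>+x. (\<integral>\<^sup>+y. ennreal (norm (u x * m (y - x))) \<partial>lborel) \<partial>lborel)"
    by (subst sigma_finite_measure.nn_integral_fst[OF sigma_finite_lborel, symmetric]) auto
  also have "\<dots> = (\<integral>\<^sup>+x. ennreal (norm (u x)) * (\<integral>\<^sup>+h. ennreal (norm (m h)) \<partial>lborel) \<partial>lborel)"
  proof (rule nn_integral_cong)
    fix x
    have "(\<integral>\<^sup>+y. ennreal (norm (u x * m (x + y - x))) \<partial>lborel)
        = (\<integral>\<^sup>+y. ennreal (norm (u x * m (y - x))) \<partial>lborel)"
      by (rule nn_integral_lborel_shift[where f="\<lambda>y. ennreal (norm (u x * m (y - x)))"]) simp
    then show "(\<integral>\<^sup>+y. ennreal (norm (u x * m (y - x))) \<partial>lborel)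
      = ennreal (norm (u x)) * (\<integral>\<^sup>+h. ennreal (norm (m h)) \<partial>lborel)"
      by (simp add: abs_mult ennreal_mult' nn_integral_cmult)
  qed
  also have "\<dots> = (\<integral>\<^sup>+x. ennreal (norm (u x)) \<partial>lborel) * (\<integral>\<^sup>+h. ennreal (norm (m h)) \<partial>lborel)"
    by (simp add: nn_integral_multc)
  also have "\<dots> < \<infinity>"
    using u m by (simp add: integrable_iff_bounded ennreal_mult_less_top)
  finally show "(\<integral>\<^sup>+z. ennreal (norm (u (fst z) * m (snd z - fst z))) \<partial>(lborel \<Otimes>\<^sub>M lborel)) < \<infinity>" .
qed

lemma distr_lborel_shear:
  "distr (lborel \<Otimes>\<^sub>M lborel) (lborel \<Otimes>\<^sub>M lborel) (\<lambda>z. (fst z, fst z + snd z))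
    = (lborel \<Otimes>\<^sub>M lborel :: ('a::euclidean_space \<times> 'a) measure)"
proof (rule measure_eqI)
  fix A :: "('a \<times> 'a) set"
  assume "A \<in> sets (distr (lborel \<Otimes>\<^sub>M lborel) (lborel \<Otimes>\<^sub>M lborel) (\<lambda>z. (fst z, fst z + snd z)))"
  then have A[measurable]: "A \<in> sets (lborel \<Otimes>\<^sub>M lborel)" by simp
  have sh[measurable]: "(\<lambda>z. (fst z, fst z + snd z :: 'a)) \<in> lborel \<Otimes>\<^sub>M lborel \<rightarrow>\<^sub>M lborel \<Otimes>\<^sub>M lborel"
    by measurable
  have "emeasure (distr (lborel \<Otimes>\<^sub>M lborel) (lborel \<Otimes>\<^sub>M lborel) (\<lambda>z. (fst z, fst z + snd z))) A
    = (\<integral>\<^sup>+z. indicator A (fst z, fst z + snd z) \<partial>(lborel \<Otimes>\<^sub>M lborel))"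
    using nn_integral_indicator[of A "distr (lborel \<Otimes>\<^sub>M lborel) (lborel \<Otimes>\<^sub>M lborel) (\<lambda>z. (fst z, fst z + snd z))"] A
      nn_integral_distr[OF sh, of "indicator A"] by (simp del: nn_integral_indicator)
  also have "\<dots> = (\<integral>\<^sup>+x. (\<integral>\<^sup>+h. indicator A (x, x + h) \<partial>lborel) \<partial>lborel)"
    by (subst sigma_finite_measure.nn_integral_fst[OF sigma_finite_lborel, symmetric]) auto
  also have "\<dots> = (\<integral>\<^sup>+x. (\<integral>\<^sup>+y. indicator A (x, y) \<partial>lborel) \<partial>lborel)"
    by (intro nn_integral_cong nn_integral_lborel_shift[where f="\<lambda>y. indicator A (_, y)"]) simp
  also have "\<dots> = (\<integral>\<^sup>+z. indicator A z \<partial>(lborel \<Otimes>\<^sub>M lborel))"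
    by (rule sigma_finite_measure.nn_integral_fst[OF sigma_finite_lborel]) simp
  also have "\<dots> = emeasure (lborel \<Otimes>\<^sub>M lborel) A" using A by (rule nn_integral_indicator)
  finally show "emeasure (distr (lborel \<Otimes>\<^sub>M lborel) (lborel \<Otimes>\<^sub>M lborel) (\<lambda>z. (fst z, fst z + snd z))) A
    = emeasure (lborel \<Otimes>\<^sub>M lborel) A" .
qed simp

text \<open>
  In the variables \<open>x\<close> and \<open>h = y - x\<close> the inner integral of \<open>\<psi> (x + h) - \<psi> x\<close> over \<open>x\<close> vanishes
  by translation invariance. The two terms of the difference need not be integrable separately
  against \<open>k\<close>, which is why the change of variables is carried out on the product measure.
\<close>

lemma integral_difference_against_kernel_eq_0:
  fixes \<psi> k :: "'a::euclidean_space \<Rightarrow> 'a"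
  assumes \<psi>: "integrable lborel \<psi>" and k[measurable]: "k \<in> borel_measurable borel"
    and int: "integrable (lborel \<Otimes>\<^sub>M lborel) (\<lambda>z. (\<psi> (snd z) - \<psi> (fst z)) \<bullet> k (snd z - fst z))"
      (is "integrable ?P ?F")
  shows "(LINT z|(lborel \<Otimes>\<^sub>M lborel). (\<psi> (snd z) - \<psi> (fst z)) \<bullet> k (snd z - fst z)) = 0"
proof -
  have [measurable]: "\<psi> \<in> borel_measurable borel" using \<psi> by simp
  let ?sh = "\<lambda>z. (fst z, fst z + snd z :: 'a)"
  have sh[measurable]: "?sh \<in> ?P \<rightarrow>\<^sub>M ?P" by measurable
  have "integrable (distr ?P ?P ?sh) ?F" using int by (simp add: distr_lborel_shear)
  then have int': "integrable ?P (\<lambda>z. ?F (?sh z))" by (rule integrable_distr[OF sh])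
  have "integral\<^sup>L ?P ?F = integral\<^sup>L (distr ?P ?P ?sh) ?F" by (simp add: distr_lborel_shear)
  also have "\<dots> = (LINT z|?P. ?F (?sh z))" using int by (intro integral_distr) auto
  also have "\<dots> = (LINT h|lborel. (LINT x|lborel. (\<psi> (x + h) - \<psi> x) \<bullet> k h))"
    using int' by (subst lborel_pair.integral_snd[where f="\<lambda>x h. (\<psi> (x + h) - \<psi> x) \<bullet> k h"])
      (simp_all add: case_prod_unfold)
  also have "\<dots> = 0"
  proof -
    have "(LINT x|lborel. (\<psi> (x + h) - \<psi> x) \<bullet> k h) = 0" for h
    proof -
      have "integrable (distr lborel borel ((+) h)) \<psi>" using \<psi> by (simp add: lborel_distr_plus)
      then have i: "integrable lborel (\<lambda>x. \<psi> (h + x))" by (rule integrable_distr[rotated]) simp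
      have "integral\<^sup>L (distr lborel borel ((+) h)) \<psi> = (LINT x|lborel. \<psi> (h + x))"
        by (rule integral_distr) auto
      then have "(LINT x|lborel. \<psi> (x + h) - \<psi> x) = 0"
        using \<psi> i by (simp add: lborel_distr_plus add.commute)
      then show ?thesis using \<psi> i by (subst integral_inner_left) (auto simp: add.commute)
    qed
    then show ?thesis by simp
  qed
  finally show ?thesis .
qed

text \<open>
  With \<open>F1\<close> and \<open>F2\<close> the integrands of the two sides of the duality formula (without the
  factor \<open>c\<close>) and \<open>\<psi> = u \<phi>\<close>, one has
  \<open>F1 (x, y) + F2 (y, x) = (\<psi> y - \<psi> x) \<bullet> k (y - x)\<close> because \<open>k\<close> is odd. All three functions are
  integrable on the product space, and the right-hand side has integral \<open>0\<close>.
\<close>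

theorem is_frac_grad_riesz_grad:
  fixes u :: "'a::euclidean_space \<Rightarrow> real"
  assumes s: "0 < s" "s < 1" and u: "integrable lborel u" and g: "gagliardo_integrable s u"
  shows "is_frac_grad c s u (riesz_grad c s u)"
  unfolding is_frac_grad_def
proof (intro conjI allI impI)
  let ?P = "lborel \<Otimes>\<^sub>M lborel :: ('a \<times> 'a) measure"
  let ?k = "riesz_kernel s :: 'a \<Rightarrow> 'a"
  have [measurable]: "u \<in> borel_measurable borel" using u by simp
  define D where "D = (\<lambda>z. (u (snd z) - u (fst z)) *\<^sub>R ?k (snd z - fst z))"
  have D: "integrable ?P D" using g by (simp add: D_def gagliardo_integrable_def)
  show "integrable lborel (riesz_grad c s u)"
    using lborel_pair.integrable_fst'[OF D] by (simp add: riesz_grad_def[abs_def] D_def)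
  fix \<phi> :: "'a \<Rightarrow> 'a" assume "test_field \<phi>"
  note tf = test_field_bounded_lipschitz[OF this]
  have [measurable]: "\<phi> \<in> borel_measurable borel" using tf(1) by (rule borel_measurable_continuous_onI)
  obtain M L where M: "\<And>x. norm (\<phi> x) \<le> M" and L: "\<And>x y. norm (\<phi> y - \<phi> x) \<le> L * norm (y - x)"
    using tf by blast
  have M0: "0 \<le> M" using M[of 0] norm_ge_zero order_trans by blast
  have L': "norm (\<phi> y - \<phi> x) \<le> \<bar>L\<bar> * norm (y - x)" for x y
    using L[where x=x and y=y] by (meson abs_ge_self mult_right_mono norm_ge_zero order_trans)
  define F1 where "F1 = (\<lambda>z. u (fst z) * ((\<phi> (snd z) - \<phi> (fst z)) \<bullet> ?k (snd z - fst z)))"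
  define F2 where "F2 = (\<lambda>z. \<phi> (fst z) \<bullet> D z)"
  have F1: "integrable ?P F1"
  proof (rule Bochner_Integration.integrable_bound[OF integrable_mult_difference[OF u integrable_truncated_kernel]])
    show "AE z in ?P. norm (F1 z) \<le> norm (u (fst z) * (min (\<bar>L\<bar> * norm (snd z - fst z)) (2 * M) * norm (?k (snd z - fst z))))"
    proof (rule AE_I2)
      fix z
      have "norm (\<phi> (snd z) - \<phi> (fst z)) \<le> min (\<bar>L\<bar> * norm (snd z - fst z)) (2 * M)"
        using L'[of "snd z" "fst z"] norm_triangle_ineq4[of "\<phi> (snd z)" "\<phi> (fst z)"] M[of "snd z"] M[of "fst z"]
        by simp
      then have "\<bar>(\<phi> (snd z) - \<phi> (fst z)) \<bullet> ?k (snd z - fst z)\<bar>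
          \<le> min (\<bar>L\<bar> * norm (snd z - fst z)) (2 * M) * norm (?k (snd z - fst z))"
        by (intro order_trans[OF Cauchy_Schwarz_ineq2] mult_right_mono) auto
      then show "norm (F1 z) \<le> norm (u (fst z) * (min (\<bar>L\<bar> * norm (snd z - fst z)) (2 * M) * norm (?k (snd z - fst z))))"
        unfolding F1_def real_norm_def abs_mult[of "u _"] by (intro mult_left_mono) auto
    qed
    show "F1 \<in> borel_measurable ?P" unfolding F1_def by measurable
  qed (use s M0 in auto)
  have F2: "integrable ?P F2"
  proof (rule Bochner_Integration.integrable_bound[OF integrable_mult_right[OF integrable_norm[OF D], of M]])
    show "F2 \<in> borel_measurable ?P" unfolding F2_def D_def by measurable
    show "AE z in ?P. norm (F2 z) \<le> norm (M * norm (D z))"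
      using M M0 by (auto intro!: AE_I2 order_trans[OF Cauchy_Schwarz_ineq2] mult_right_mono simp: F2_def)
  qed
  define \<psi> where "\<psi> = (\<lambda>x. u x *\<^sub>R \<phi> x)"
  have \<psi>: "integrable lborel \<psi>"
  proof (rule Bochner_Integration.integrable_bound[OF integrable_mult_right[OF u, of M]])
    show "AE x in lborel. norm (\<psi> x) \<le> norm (M * u x)"
    proof (rule AE_I2)
      fix x
      show "norm (\<psi> x) \<le> norm (M * u x)"
        using mult_left_mono[OF M[of x] abs_ge_zero[of "u x"]] M0 by (simp add: \<psi>_def abs_mult mult.commute)
    qed
  qed (simp add: \<psi>_def)
  have F2': "integrable ?P (\<lambda>(x, y). F2 (y, x))"
    by (rule lborel_pair.integrable_product_swap[OF F2])
  \<comment> \<open>The exchange of variables turns \<open>\<phi> x\<close> in \<open>F2\<close> into \<open>\<phi> y\<close>; the signs of \<open>u y - u x\<close> and of the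
    odd kernel both change and cancel.\<close>
  have split: "(\<psi> (snd z) - \<psi> (fst z)) \<bullet> ?k (snd z - fst z) = F1 z + (\<lambda>(x, y). F2 (y, x)) z" for z
    using riesz_kernel_minus[of s "snd z - fst z"]
    by (simp add: F1_def F2_def D_def \<psi>_def case_prod_unfold inner_diff_left algebra_simps)
  have "0 = (LINT z|?P. F1 z + (\<lambda>(x, y). F2 (y, x)) z)"
    using integral_difference_against_kernel_eq_0[OF \<psi>, of ?k] F1 F2' by (simp add: split)
  also have "\<dots> = integral\<^sup>L ?P F1 + integral\<^sup>L ?P F2"
    using F1 F2' lborel_pair.integral_product_swap[of F2] F2 by simp
  finally have sum: "integral\<^sup>L ?P F1 + integral\<^sup>L ?P F2 = 0" by simp
  have "(LINT x|lborel. u x * frac_div c s \<phi> x) = (LINT x|lborel. c * (LINT y|lborel. F1 (x, y)))"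
    by (simp add: frac_div_eq F1_def mult.left_commute)
  also have "\<dots> = c * integral\<^sup>L ?P F1"
    using lborel_pair.integral_fst'[OF F1] by simp
  finally have 1: "(LINT x|lborel. u x * frac_div c s \<phi> x) = c * integral\<^sup>L ?P F1" .
  have "(LINT x|lborel. \<phi> x \<bullet> riesz_grad c s u x) = (LINT x|lborel. c * (LINT y|lborel. F2 (x, y)))"
  proof (rule integral_cong_AE)
    show "AE x in lborel. \<phi> x \<bullet> riesz_grad c s u x = c * (LINT y|lborel. F2 (x, y))"
      using lborel_pair.AE_integrable_fst'[OF D]
    proof eventually_elim
      case (elim x)
      then have "(LINT y|lborel. \<phi> x \<bullet> D (x, y)) = \<phi> x \<bullet> (LINT y|lborel. D (x, y))"
        by (intro integral_inner_right)
      moreover have "riesz_grad c s u x = c *\<^sub>R (LINT y|lborel. D (x, y))"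
        by (simp add: riesz_grad_def D_def)
      ultimately show ?case by (simp add: F2_def)
    qed
    have [measurable]: "riesz_grad c s u \<in> borel_measurable borel"
      using \<open>integrable lborel (riesz_grad c s u)\<close> by simp
    show "(\<lambda>x. \<phi> x \<bullet> riesz_grad c s u x) \<in> borel_measurable lborel" by simp
    show "(\<lambda>x. c * (LINT y|lborel. F2 (x, y))) \<in> borel_measurable lborel"
      using lborel_pair.integrable_fst'[OF F2] by (intro borel_measurable_times) auto
  qed
  also have "\<dots> = c * integral\<^sup>L ?P F2"
    using lborel_pair.integral_fst'[OF F2] by simp
  finally have 2: "(LINT x|lborel. \<phi> x \<bullet> riesz_grad c s u x) = c * integral\<^sup>L ?P F2" .
  have "integral\<^sup>L ?P F1 = - integral\<^sup>L ?P F2" using sum by linarith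
  then show "(LINT x|lborel. u x * frac_div c s \<phi> x) = - (LINT x|lborel. \<phi> x \<bullet> riesz_grad c s u x)"
    unfolding 1 2 by simp
qed

theorem frac_grad_AE_eq_riesz_grad:
  fixes u :: "'a::euclidean_space \<Rightarrow> real"
  assumes s: "0 < s" "s < 1" and u: "integrable lborel u" and g: "gagliardo_integrable s u"
  shows "AE x in lborel. frac_grad c s u x = riesz_grad c s u x"
proof -
  note r = is_frac_grad_riesz_grad[OF assms, of c]
  then have f: "is_frac_grad c s u (frac_grad c s u)"
    unfolding frac_grad_def by (rule someI[where P="is_frac_grad c s u"])
  have ir: "integrable lborel (riesz_grad c s u)" and "integrable lborel (frac_grad c s u)"
    using r f by (auto simp: is_frac_grad_def)
  have "AE x in lborel. frac_grad c s u x - riesz_grad c s u x = 0"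
  proof (rule AE_zero_if_orthogonal_to_test_fields)
    fix \<phi> :: "'a \<Rightarrow> 'a" assume tf: "test_field \<phi>"
    have [measurable]: "\<phi> \<in> borel_measurable borel"
      using test_field_bounded_lipschitz(1)[OF tf] by (rule borel_measurable_continuous_onI)
    obtain M where M: "\<And>x. norm (\<phi> x) \<le> M" using test_field_bounded_lipschitz(2)[OF tf] by blast
    have int: "integrable lborel (\<lambda>x. \<phi> x \<bullet> h x)" if h: "integrable lborel h" for h
    proof (rule Bochner_Integration.integrable_bound[OF integrable_mult_right[OF integrable_norm[OF h], of M]])
      show "AE x in lborel. norm (\<phi> x \<bullet> h x) \<le> norm (M * norm (h x))"
        by (auto intro!: AE_I2 order_trans[OF Cauchy_Schwarz_ineq2] order_trans[OF mult_right_mono[OF M]])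
    qed (use h in simp)
    show "(LINT x|lborel. \<phi> x \<bullet> (frac_grad c s u x - riesz_grad c s u x)) = 0"
      using r f tf int[OF ir] int[OF \<open>integrable lborel (frac_grad c s u)\<close>]
      by (simp add: is_frac_grad_def inner_diff_right)
  qed (use r f in \<open>simp add: is_frac_grad_def\<close>)
  then show ?thesis by simp
qed

section \<open>Fractional gradients of balls: size\<close>

lemma power_diff_le:
  fixes a b :: real
  assumes "0 \<le> a" "a \<le> b"
  shows "b ^ n - a ^ n \<le> real n * b ^ (n - 1) * (b - a)"
proof (induction n)
  case (Suc n)
  have "b ^ Suc n - a ^ Suc n = b * (b ^ n - a ^ n) + a ^ n * (b - a)"
    by (simp add: algebra_simps)
  also have "\<dots> \<le> b * (real n * b ^ (n - 1) * (b - a)) + b ^ n * (b - a)"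
    using assms Suc by (intro add_mono mult_left_mono mult_right_mono power_mono) auto
  also have "\<dots> = real (Suc n) * b ^ (Suc n - 1) * (b - a)"
    by (cases n) (auto simp: algebra_simps)
  finally show ?case .
qed simp

definition sphere_dist :: "'a::euclidean_space \<Rightarrow> real \<Rightarrow> 'a \<Rightarrow> real" where
  "sphere_dist z R x = \<bar>norm (x - z) - R\<bar>"

lemma sphere_dist_measurable [measurable]: "sphere_dist z R \<in> borel_measurable borel"
  unfolding sphere_dist_def[abs_def] by measurable

text \<open>
  The neighbourhood lies in the shell between the radii \<open>max 0 (R - t)\<close> and \<open>R + t\<close>, whose volume
  is estimated with the mean value bound for \<open>r ^ N\<close>.
\<close>

lemma emeasure_sphere_neighbourhood_le:
  fixes z :: "'a::euclidean_space"
  assumes R: "0 < R"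
  shows "\<exists>C\<ge>0. \<forall>t. 0 < t \<and> t \<le> 1 \<longrightarrow> emeasure lborel {x. sphere_dist z R x \<le> t} \<le> ennreal (C * t)"
proof (intro exI conjI allI impI)
  let ?N = "DIM('a)"
  let ?w = "unit_ball_vol (real ?N)"
  let ?C = "?w * (real ?N * (R + 1) ^ (?N - 1) * 2)"
  show "0 \<le> ?C" using R by simp
  fix t :: real assume t: "0 < t \<and> t \<le> 1"
  define a where "a = max 0 (R - t)"
  have a: "0 \<le> a" "a \<le> R + t" "R + t - a \<le> 2 * t" using t R by (auto simp: a_def)
  have sub: "ball z a \<subseteq> cball z (R + t)" using a by auto
  have "emeasure lborel {x. sphere_dist z R x \<le> t} \<le> emeasure lborel (cball z (R + t) - ball z a)"
  proof (intro emeasure_mono subsetI)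
    fix x assume "x \<in> {x. sphere_dist z R x \<le> t}"
    then show "x \<in> cball z (R + t) - ball z a"
      using norm_ge_zero[of "x - z"] unfolding a_def mem_Collect_eq sphere_dist_def Diff_iff mem_cball mem_ball
      by (simp only: dist_norm norm_minus_commute[of z x]) linarith
  qed simp
  also have "\<dots> = emeasure lborel (cball z (R + t)) - emeasure lborel (ball z a)"
    using sub a by (intro emeasure_Diff) (auto simp: emeasure_ball)
  also have "\<dots> = ennreal (?w * ((R + t) ^ ?N - a ^ ?N))"
    using a t R by (simp add: emeasure_ball emeasure_cball ennreal_minus right_diff_distrib)
  also have "(R + t) ^ ?N - a ^ ?N \<le> real ?N * (R + t) ^ (?N - 1) * (R + t - a)"
    using a by (intro power_diff_le) auto
  also have "\<dots> \<le> real ?N * (R + 1) ^ (?N - 1) * (2 * t)"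
    using a t R by (intro mult_mono power_mono) auto
  finally show "emeasure lborel {x. sphere_dist z R x \<le> t} \<le> ennreal (?C * t)"
    by (simp add: ennreal_leI mult_left_mono algebra_simps)
qed

lemma AE_sphere_dist_pos: "AE x in lborel. 0 < sphere_dist z R x"
proof -
  have "sphere z R \<in> null_sets lborel"
    using negligible_sphere[of z R] by (simp add: negligible_iff_null_sets null_sets_completion_iff)
  then have "AE x in lborel. x \<notin> sphere z R" by (rule AE_not_in)
  then show ?thesis
    by eventually_elim (auto simp: sphere_dist_def dist_norm norm_minus_commute)
qed

lemma nn_integral_sphere_dist_powr_finite:
  assumes R: "0 < R" and a: "0 < a" "a < 1"
  shows "(\<integral>\<^sup>+x. ennreal (sphere_dist z R x powr (- a)) * indicator {x. sphere_dist z R x \<le> 1} x \<partial>lborel) < \<infinity>"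
proof -
  obtain C where C: "0 \<le> C" "\<And>t. 0 < t \<Longrightarrow> t \<le> 1 \<Longrightarrow> emeasure lborel {x. sphere_dist z R x \<le> t} \<le> ennreal (C * t)"
    using emeasure_sphere_neighbourhood_le[OF R] by blast
  show ?thesis
  proof (rule nn_integral_powr_near_finite[OF _ _ _ a C(1)])
    fix t :: real assume t: "0 < t" "t \<le> 1"
    have "{x \<in> {x. sphere_dist z R x \<le> 1}. sphere_dist z R x \<le> t} = {x. sphere_dist z R x \<le> t}"
      using t by auto
    then show "emeasure lborel {x \<in> {x. sphere_dist z R x \<le> 1}. sphere_dist z R x \<le> t} \<le> ennreal (C * t powr 1)"
      using C(2)[OF t] t by simp
  qed (auto simp: sphere_dist_def)
qed

lemma sphere_dist_le_if_separated:
  assumes "indicat_real (ball z R) y \<noteq> indicat_real (ball z R) x"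
  shows "sphere_dist z R x \<le> norm (y - x)"
proof -
  have "\<bar>norm (y - z) - norm (x - z)\<bar> \<le> norm (y - x)"
    using norm_triangle_ineq3[of "y - z" "x - z"] by simp
  moreover have "(norm (y - z) < R) \<noteq> (norm (x - z) < R)"
    using assms by (auto simp: indicator_def dist_norm norm_minus_commute)
  ultimately show ?thesis unfolding sphere_dist_def by linarith
qed

text \<open>
  The type argument carries the dimension, which the exponent \<open>s\<close> alone does not determine.
\<close>

definition tail_const :: "'a::euclidean_space itself \<Rightarrow> real \<Rightarrow> real" where
  "tail_const _ s = (real DIM('a) + s) * unit_ball_vol (real DIM('a)) / s"

lemma tail_const_nonneg: "0 < s \<Longrightarrow> 0 \<le> tail_const TYPE('a::euclidean_space) s"
  by (simp add: tail_const_def)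

text \<open>
  The integrand vanishes for \<open>|y - x| < d\<close>, where \<open>d\<close> is the distance of \<open>x\<close> from the sphere, so
  the kernel is integrated over the complement of a ball of radius \<open>d\<close> only.
\<close>

lemma nn_integral_ball_difference_le:
  fixes z x :: "'a::euclidean_space"
  assumes s: "0 < s" and x: "0 < sphere_dist z R x"
  shows "(\<integral>\<^sup>+y. ennreal (norm ((indicat_real (ball z R) y - indicat_real (ball z R) x) *\<^sub>R riesz_kernel s (y - x))) \<partial>lborel)
    \<le> ennreal (tail_const TYPE('a) s * sphere_dist z R x powr (- s))"
proof -
  let ?d = "sphere_dist z R x"
  have "(\<integral>\<^sup>+y. ennreal (norm ((indicat_real (ball z R) y - indicat_real (ball z R) x) *\<^sub>R riesz_kernel s (y - x))) \<partial>lborel)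
    \<le> (\<integral>\<^sup>+y. ennreal (norm (y - x) powr (- (real DIM('a) + s))) * indicator {h. ?d \<le> norm h} (y - x) \<partial>lborel)"
  proof (rule nn_integral_mono)
    fix y
    show "ennreal (norm ((indicat_real (ball z R) y - indicat_real (ball z R) x) *\<^sub>R riesz_kernel s (y - x)))
      \<le> ennreal (norm (y - x) powr (- (real DIM('a) + s))) * indicator {h. ?d \<le> norm h} (y - x)"
    proof (cases "indicat_real (ball z R) y = indicat_real (ball z R) x")
      case False
      then have "\<bar>indicat_real (ball z R) y - indicat_real (ball z R) x\<bar> = 1"
        by (auto simp: indicator_def split: if_splits)
      then show ?thesis
        using sphere_dist_le_if_separated[OF False] by (simp add: norm_riesz_kernel)
    qed simp
  qed
  also have "\<dots> = (\<integral>\<^sup>+y. ennreal (norm (x + y - x) powr (- (real DIM('a) + s))) * indicator {h. ?d \<le> norm h} (x + y - x) \<partial>lborel)"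
  proof -
    have [measurable]: "{h::'a. ?d \<le> norm h} \<in> sets borel" by simp
    show ?thesis
      by (rule nn_integral_lborel_shift[symmetric, where f="\<lambda>y. ennreal (norm (y - x) powr (- (real DIM('a) + s))) * indicator {h. ?d \<le> norm h} (y - x)"])
        measurable
  qed
  also have "\<dots> \<le> ennreal (tail_const TYPE('a) s * ?d powr (- s))"
    using nn_integral_powr_tail_le[OF x s, where 'a='a] by (simp add: tail_const_def)
  finally show ?thesis .
qed

lemma integrable_ball_difference:
  fixes z x :: "'a::euclidean_space"
  assumes s: "0 < s" and x: "0 < sphere_dist z R x"
  shows "integrable lborel (\<lambda>y. (indicat_real (ball z R) y - indicat_real (ball z R) x) *\<^sub>R riesz_kernel s (y - x))"
proof (rule integrableI_bounded)
  have [measurable]: "ball z R \<in> sets borel" by simp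
  show "(\<lambda>y. (indicat_real (ball z R) y - indicat_real (ball z R) x) *\<^sub>R riesz_kernel s (y - x)) \<in> borel_measurable lborel"
    by measurable
qed (rule order_le_less_trans[OF nn_integral_ball_difference_le[OF assms]], simp)

lemma norm_riesz_grad_ball_le:
  fixes z x :: "'a::euclidean_space"
  assumes s: "0 < s" and x: "0 < sphere_dist z R x"
  shows "norm (riesz_grad c s (indicat_real (ball z R)) x) \<le> \<bar>c\<bar> * tail_const TYPE('a) s * sphere_dist z R x powr (- s)"
proof -
  let ?I = "LINT y|lborel. (indicat_real (ball z R) y - indicat_real (ball z R) x) *\<^sub>R riesz_kernel s (y - x)"
  have "ennreal (norm ?I) \<le> ennreal (tail_const TYPE('a) s * sphere_dist z R x powr (- s))"
    by (rule order_trans[OF integral_norm_bound_ennreal[OF integrable_ball_difference[OF assms]]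
          nn_integral_ball_difference_le[OF assms]])
  then have "norm ?I \<le> tail_const TYPE('a) s * sphere_dist z R x powr (- s)"
    using tail_const_nonneg[OF s, where 'a='a] by (subst (asm) ennreal_le_iff) auto
  then show ?thesis
    by (simp add: riesz_grad_def mult.assoc mult_left_mono)
qed

text \<open>
  By symmetry in \<open>x\<close> and \<open>y\<close> it suffices to integrate over \<open>x\<close> inside the ball. There the inner
  integral is at most a constant times \<open>d powr (- s)\<close>, which is integrable near the sphere since
  \<open>s < 1\<close>.
\<close>

lemma gagliardo_integrable_ball:
  fixes z :: "'a::euclidean_space"
  assumes s: "0 < s" "s < 1" and R: "0 < R"
  shows "gagliardo_integrable s (indicat_real (ball z R))"
  unfolding gagliardo_integrable_def
proof (rule integrableI_bounded)
  let ?w = "indicat_real (ball z R)"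
  let ?k = "riesz_kernel s :: 'a \<Rightarrow> 'a"
  let ?C = "tail_const TYPE('a) s"
  let ?S = "{x. sphere_dist z R x \<le> 1}"
  have [measurable]: "ball z R \<in> sets borel" "?S \<in> sets borel" by simp_all
  show "(\<lambda>p. (?w (snd p) - ?w (fst p)) *\<^sub>R ?k (snd p - fst p)) \<in> borel_measurable (lborel \<Otimes>\<^sub>M lborel)"
    by measurable
  \<comment> \<open>\<open>f\<close> is the part of the integrand with \<open>x\<close> inside and \<open>y\<close> outside the ball.\<close>
  define f where "f x y = indicator (ball z R) x * ennreal (norm ((?w y - ?w x) *\<^sub>R ?k (y - x)))" for x y
  have [measurable]: "(\<lambda>p. f (fst p) (snd p)) \<in> borel_measurable (lborel \<Otimes>\<^sub>M lborel)"
    "(\<lambda>p. f (snd p) (fst p)) \<in> borel_measurable (lborel \<Otimes>\<^sub>M lborel)"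
    "f x \<in> borel_measurable lborel" "(\<lambda>y. f y x) \<in> borel_measurable lborel"
    "(\<lambda>x. \<integral>\<^sup>+y. f x y \<partial>lborel) \<in> borel_measurable lborel"
    "(\<lambda>x. \<integral>\<^sup>+y. f y x \<partial>lborel) \<in> borel_measurable lborel" for x
    unfolding f_def by measurable
  have "(\<integral>\<^sup>+p. ennreal (norm ((?w (snd p) - ?w (fst p)) *\<^sub>R ?k (snd p - fst p))) \<partial>(lborel \<Otimes>\<^sub>M lborel))
      = (\<integral>\<^sup>+x. (\<integral>\<^sup>+y. ennreal (norm ((?w y - ?w x) *\<^sub>R ?k (y - x))) \<partial>lborel) \<partial>lborel)"
    by (subst sigma_finite_measure.nn_integral_fst[OF sigma_finite_lborel, symmetric]) auto
  also have "\<dots> \<le> (\<integral>\<^sup>+x. (\<integral>\<^sup>+y. f x y + f y x \<partial>lborel) \<partial>lborel)"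
  proof (intro nn_integral_mono)
    fix x y
    have "norm (?k (y - x)) = norm (?k (x - y))"
      using riesz_kernel_minus[of s "y - x"] by (metis minus_diff_eq norm_minus_cancel)
    then show "ennreal (norm ((?w y - ?w x) *\<^sub>R ?k (y - x))) \<le> f x y + f y x"
      by (auto simp: f_def indicator_def)
  qed
  also have "\<dots> = (\<integral>\<^sup>+x. (\<integral>\<^sup>+y. f x y \<partial>lborel) \<partial>lborel) + (\<integral>\<^sup>+x. (\<integral>\<^sup>+y. f y x \<partial>lborel) \<partial>lborel)"
    by (simp add: nn_integral_add)
  also have "(\<integral>\<^sup>+x. (\<integral>\<^sup>+y. f y x \<partial>lborel) \<partial>lborel) = (\<integral>\<^sup>+y. (\<integral>\<^sup>+x. f y x \<partial>lborel) \<partial>lborel)"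
    by (rule lborel_pair.Fubini'[symmetric]) (simp add: case_prod_unfold)
  finally have le: "(\<integral>\<^sup>+p. ennreal (norm ((?w (snd p) - ?w (fst p)) *\<^sub>R ?k (snd p - fst p))) \<partial>(lborel \<Otimes>\<^sub>M lborel))
    \<le> (\<integral>\<^sup>+x. (\<integral>\<^sup>+y. f x y \<partial>lborel) \<partial>lborel) + (\<integral>\<^sup>+x. (\<integral>\<^sup>+y. f x y \<partial>lborel) \<partial>lborel)" .
  have fin: "(\<integral>\<^sup>+x. (\<integral>\<^sup>+y. f x y \<partial>lborel) \<partial>lborel) < \<infinity>"
  proof -
    have "(\<integral>\<^sup>+x. (\<integral>\<^sup>+y. f x y \<partial>lborel) \<partial>lborel)
      \<le> (\<integral>\<^sup>+x. ennreal ?C * (ennreal (sphere_dist z R x powr (- s)) * indicator ?S x) + ennreal ?C * indicator (ball z R) x \<partial>lborel)"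
    proof (rule nn_integral_mono)
      fix x
      show "(\<integral>\<^sup>+y. f x y \<partial>lborel)
        \<le> ennreal ?C * (ennreal (sphere_dist z R x powr (- s)) * indicator ?S x) + ennreal ?C * indicator (ball z R) x"
      proof (cases "x \<in> ball z R")
        case True
        then have d: "0 < sphere_dist z R x" by (auto simp: sphere_dist_def dist_norm norm_minus_commute)
        have "(\<integral>\<^sup>+y. f x y \<partial>lborel) \<le> ennreal (?C * sphere_dist z R x powr (- s))"
          using nn_integral_ball_difference_le[OF s(1) d] True by (simp add: f_def)
        also have "\<dots> = ennreal ?C * ennreal (sphere_dist z R x powr (- s))"
          using tail_const_nonneg[OF s(1), where 'a='a] by (intro ennreal_mult) auto
        also have "\<dots> \<le> ennreal ?C * (ennreal (sphere_dist z R x powr (- s)) * indicator ?S x) + ennreal ?C * indicator (ball z R) x"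
        proof (cases "sphere_dist z R x \<le> 1")
          case False
          then have "sphere_dist z R x powr (- s) \<le> 1"
            using s ge_one_powr_ge_zero[of "sphere_dist z R x" s] by (simp add: powr_minus inverse_le_1_iff)
          then have "ennreal (sphere_dist z R x powr (- s)) \<le> 1" by simp
          then have "ennreal ?C * ennreal (sphere_dist z R x powr (- s)) \<le> ennreal ?C * 1"
            by (rule mult_left_mono) simp
          then show ?thesis using True False by simp
        qed simp
        finally show ?thesis .
      qed (simp add: f_def)
    qed
    also have "\<dots> = ennreal ?C * (\<integral>\<^sup>+x. ennreal (sphere_dist z R x powr (- s)) * indicator ?S x \<partial>lborel)
        + ennreal ?C * emeasure lborel (ball z R)"
      by (subst nn_integral_add) (auto simp: nn_integral_cmult)
    also have "\<dots> < \<infinity>"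
      using nn_integral_sphere_dist_powr_finite[OF R s, of z] R
      by (simp add: ennreal_mult_less_top emeasure_ball)
    finally show ?thesis .
  qed
  show "(\<integral>\<^sup>+p. ennreal (norm ((?w (snd p) - ?w (fst p)) *\<^sub>R ?k (snd p - fst p))) \<partial>(lborel \<Otimes>\<^sub>M lborel)) < \<infinity>"
    using fin by (intro order_le_less_trans[OF le]) simp
qed

lemma integrable_indicator_ball: "integrable lborel (indicat_real (ball z R :: 'a::euclidean_space set))"
  using emeasure_lborel_ball_finite[of z R] by (simp add: integrable_indicator_iff)

lemma integrable_riesz_grad_ball:
  assumes "0 < s" "s < 1" "0 < R"
  shows "integrable lborel (riesz_grad c s (indicat_real (ball z R)))"
  using is_frac_grad_riesz_grad[OF assms(1,2) integrable_indicator_ball gagliardo_integrable_ball[OF assms], of c z]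
  by (simp add: is_frac_grad_def)

text \<open>
  Near the sphere the \<open>a\<close>-th power is dominated by \<open>d powr (- a * s)\<close> with \<open>a * s < 1\<close>. Away from it
  the gradient \<open>g\<close> is bounded, and \<open>|g| powr a\<close> is dominated by a multiple of the integrable \<open>|g|\<close>.
\<close>

lemma nn_integral_riesz_grad_ball_powr_finite:
  fixes z :: "'a::euclidean_space"
  assumes s: "0 < s" "s < 1" and R: "0 < R" and a: "1 \<le> a" "a * s < 1"
  shows "(\<integral>\<^sup>+x. ennreal (norm (riesz_grad c s (indicat_real (ball z R)) x) powr a) \<partial>lborel) < \<infinity>"
proof -
  let ?g = "riesz_grad c s (indicat_real (ball z R))"
  let ?S = "{x. sphere_dist z R x \<le> 1}"
  \<comment> \<open>\<open>K\<close> is the constant in the bound \<open>K * d powr (- s)\<close> for the gradient.\<close>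
  define K where "K = \<bar>c\<bar> * tail_const TYPE('a) s"
  have K: "0 \<le> K" using tail_const_nonneg[OF s(1), where 'a='a] by (simp add: K_def)
  have [measurable]: "?S \<in> sets borel" by simp
  have int: "integrable lborel ?g" by (rule integrable_riesz_grad_ball[OF s R])
  then have [measurable]: "?g \<in> borel_measurable borel" by simp
  have "(\<integral>\<^sup>+x. ennreal (norm (?g x) powr a) \<partial>lborel)
    \<le> (\<integral>\<^sup>+x. ennreal (K powr a) * (ennreal (sphere_dist z R x powr (- (a * s))) * indicator ?S x)
          + ennreal (K powr (a - 1)) * ennreal (norm (?g x)) \<partial>lborel)"
  proof (rule nn_integral_mono_AE)
    show "AE x in lborel. ennreal (norm (?g x) powr a)
      \<le> ennreal (K powr a) * (ennreal (sphere_dist z R x powr (- (a * s))) * indicator ?S x)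
          + ennreal (K powr (a - 1)) * ennreal (norm (?g x))"
      using AE_sphere_dist_pos[of z R]
    proof eventually_elim
      case (elim x)
      let ?d = "sphere_dist z R x"
      have g: "norm (?g x) \<le> K * ?d powr (- s)"
        using norm_riesz_grad_ball_le[OF s(1) elim] by (simp add: K_def)
      show ?case
      proof (cases "?d \<le> 1")
        case True
        have "norm (?g x) powr a \<le> (K * ?d powr (- s)) powr a"
          using g a by (intro powr_mono2) auto
        also have "\<dots> = K powr a * ?d powr (- (a * s))"
          using K by (simp add: powr_mult powr_powr mult.commute)
        finally have "ennreal (norm (?g x) powr a) \<le> ennreal (K powr a) * ennreal (?d powr (- (a * s)))"
          by (simp add: ennreal_mult'[symmetric] ennreal_leI)
        then show ?thesis using True by (simp add: add_increasing2)
      next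
        case False
        have "?d powr (- s) \<le> 1" using False s ge_one_powr_ge_zero[of ?d s] by (simp add: powr_minus inverse_le_1_iff)
        then have "norm (?g x) \<le> K" using g K mult_left_le[of "?d powr (- s)" K] by linarith
        then have "norm (?g x) powr (a - 1) * norm (?g x) \<le> K powr (a - 1) * norm (?g x)"
          using a by (intro mult_right_mono powr_mono2) auto
        moreover have "norm (?g x) powr (a - 1) * norm (?g x) = norm (?g x) powr a"
          using powr_add[of "norm (?g x)" "a - 1" 1] by (cases "?g x = 0") auto
        ultimately have "ennreal (norm (?g x) powr a) \<le> ennreal (K powr (a - 1)) * ennreal (norm (?g x))"
          by (simp add: ennreal_mult'[symmetric] ennreal_leI)
        then show ?thesis by (simp add: add_increasing)
      qed
    qed
  qed
  also have "\<dots> = ennreal (K powr a) * (\<integral>\<^sup>+x. ennreal (sphere_dist z R x powr (- (a * s))) * indicator ?S x \<partial>lborel)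
      + ennreal (K powr (a - 1)) * (\<integral>\<^sup>+x. ennreal (norm (?g x)) \<partial>lborel)"
    by (subst nn_integral_add) (auto simp: nn_integral_cmult)
  also have "\<dots> < \<infinity>"
    using nn_integral_sphere_dist_powr_finite[OF R, of "a * s" z] s a int
    by (simp add: ennreal_mult_less_top integrable_iff_bounded)
  finally show ?thesis .
qed

section \<open>Fractional gradients of balls: direction\<close>

lemma riesz_grad_ball_translate:
  "riesz_grad c s (indicat_real (ball z R)) x = riesz_grad c s (indicat_real (ball 0 R)) (x - z)"
proof -
  let ?w = "indicat_real (ball z R)" and ?v = "indicat_real (ball 0 R)"
  have [measurable]: "ball z R \<in> sets borel" by simp
  have w: "?w (z + y) = ?v y" "?w x = ?v (x - z)" for y
    by (simp_all add: indicator_def dist_norm norm_minus_commute[of z x])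
  have "(LINT y|lborel. (?w (z + y) - ?w x) *\<^sub>R riesz_kernel s (z + y - x))
      = (LINT y|lborel. (?w y - ?w x) *\<^sub>R riesz_kernel s (y - x))"
    by (rule integral_lborel_shift[where f="\<lambda>y. (?w y - ?w x) *\<^sub>R riesz_kernel s (y - x)"]) measurable
  moreover have "z + y - x = y - (x - z)" for y by simp
  ultimately show ?thesis by (simp only: riesz_grad_def w)
qed

text \<open>
  The ball and the kernel are equivariant under linear isometries; if in addition \<open>T\<close> fixes \<open>x\<close>, the
  substitution \<open>y \<mapsto> T y\<close> reproduces the integral at \<open>x\<close>.
\<close>

lemma riesz_grad_ball_isometry_fixed:
  fixes T :: "'a::euclidean_space \<Rightarrow> 'a"
  assumes s: "0 < s" and T: "linear T" "\<And>x. norm (T x) = norm x"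
    and x: "T x = x" "norm x \<noteq> R"
  shows "T (riesz_grad c s (indicat_real (ball 0 R)) x) = riesz_grad c s (indicat_real (ball 0 R)) x"
proof -
  let ?w = "indicat_real (ball (0::'a) R)"
  let ?f = "\<lambda>y. (?w y - ?w x) *\<^sub>R riesz_kernel s (y - x)"
  have [measurable]: "ball (0::'a) R \<in> sets borel" by simp
  have int: "integrable lborel ?f"
    using x(2) by (intro integrable_ball_difference[OF s]) (auto simp: sphere_dist_def)
  have "?f (T y) = T (?f y)" for y
  proof -
    have "T y - x = T (y - x)" using x(1) T(1) by (simp add: linear_diff)
    moreover have "?w (T y) = ?w y" by (simp add: indicator_def T(2))
    ultimately show ?thesis by (simp add: riesz_kernel_def T linear_scale[OF T(1)])
  qed
  then have "integral\<^sup>L lborel ?f = (LINT y|lborel. T (?f y))"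
    using linear_isometry_integral[OF T, of ?f] by simp
  also have "\<dots> = T (integral\<^sup>L lborel ?f)"
    using T(1) int by (intro integral_bounded_linear) (simp add: linear_conv_bounded_linear)
  finally show ?thesis
    by (simp add: riesz_grad_def linear_scale[OF T(1)])
qed

text \<open>
  The reflection in the hyperplane orthogonal to \<open>v\<close> fixes \<open>x\<close>, hence fixes the gradient at \<open>x\<close>.
\<close>

lemma riesz_grad_ball_orthogonal:
  fixes x v :: "'a::euclidean_space"
  assumes s: "0 < s" and x: "norm x \<noteq> R" and v: "x \<bullet> v = 0"
  shows "riesz_grad c s (indicat_real (ball 0 R)) x \<bullet> v = 0"
proof (cases "v = 0")
  case False
  define T where "T y = y - (2 * (y \<bullet> v) / (v \<bullet> v)) *\<^sub>R v" for y
  have lin: "linear T"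
    by (rule linearI) (simp_all add: T_def inner_add_left algebra_simps add_divide_distrib)
  have "norm (T y) = norm y" for y
  proof -
    have "T y \<bullet> T y = y \<bullet> y"
      using False by (simp add: T_def inner_diff_left inner_diff_right inner_commute power2_eq_square field_simps)
    then show ?thesis by (simp add: norm_eq_sqrt_inner)
  qed
  moreover have "T x = x" using v by (simp add: T_def)
  ultimately have "T (riesz_grad c s (indicat_real (ball 0 R)) x) = riesz_grad c s (indicat_real (ball 0 R)) x"
    using riesz_grad_ball_isometry_fixed[OF s lin] x by blast
  then show ?thesis using False by (simp add: T_def)
qed simp

text \<open>
  With \<open>y = x + h\<close>, averaging over \<open>h\<close> and \<open>- h\<close> turns the integrand into
  \<open>(w (x + h) - w (x - h)) * (k h \<bullet> x) / 2\<close>, with \<open>w\<close> the indicator of the ball. If \<open>h \<bullet> x > 0\<close>, then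
  \<open>x + h\<close> is farther from the origin than \<open>x - h\<close>, so the integrand is nonpositive; it is negative
  where in addition the sphere separates \<open>x + h\<close> from \<open>x - h\<close>.
\<close>

lemma riesz_grad_ball_inner_nonpos:
  fixes x :: "'a::euclidean_space"
  assumes s: "0 < s" and c: "0 < c" and x: "norm x \<noteq> R"
  shows "riesz_grad c s (indicat_real (ball 0 R)) x \<bullet> x \<le> 0"
    and "x \<noteq> 0 \<Longrightarrow> norm x < R \<Longrightarrow> riesz_grad c s (indicat_real (ball 0 R)) x \<bullet> x < 0"
proof -
  let ?w = "indicat_real (ball (0::'a) R)"
  let ?f = "\<lambda>y. (?w y - ?w x) *\<^sub>R riesz_kernel s (y - x)"
  have [measurable]: "ball (0::'a) R \<in> sets borel" by simp
  have int: "integrable lborel ?f"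
    using x by (intro integrable_ball_difference[OF s]) (auto simp: sphere_dist_def)
  define g where "g h = ?f (x + h) \<bullet> x" for h
  have ig: "integrable lborel g"
    unfolding g_def by (intro integrable_inner_left integrable_lborel_shift[OF int])
  have gm[measurable]: "g \<in> borel_measurable borel" using ig by simp
  have neg: "integral\<^sup>L lborel (\<lambda>h. g (- h)) = integral\<^sup>L lborel g"
    by (rule linear_isometry_integral) (auto simp: linear_uminus)
  have ineg: "integrable lborel (\<lambda>h. g (- h))"
  proof -
    have "distr lborel borel (uminus :: 'a \<Rightarrow> 'a) = lborel"
      by (rule distr_lborel_isometry) (auto simp: linear_uminus)
    then show ?thesis using ig integrable_distr[of "uminus :: 'a \<Rightarrow> 'a" lborel borel g] by simp
  qed
  have "integral\<^sup>L lborel g = (LINT h|lborel. ?f (x + h)) \<bullet> x"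
    unfolding g_def by (intro integral_inner_left integrable_lborel_shift[OF int])
  also have "(LINT h|lborel. ?f (x + h)) = integral\<^sup>L lborel ?f"
    by (rule integral_lborel_shift) measurable
  finally have grad: "riesz_grad c s ?w x \<bullet> x = c * integral\<^sup>L lborel g"
    by (simp add: riesz_grad_def)
  define p where "p h = g h + g (- h)" for h
  have ip: "integrable lborel p" unfolding p_def using ig ineg by simp
  have intp: "integral\<^sup>L lborel p = 2 * integral\<^sup>L lborel g"
    unfolding p_def using ig ineg neg by simp
  have p: "p h = (?w (x + h) - ?w (x - h)) * (riesz_kernel s h \<bullet> x)" for h
    by (simp add: p_def g_def riesz_kernel_minus algebra_simps)
  have kx: "riesz_kernel s h \<bullet> x = (h \<bullet> x) / norm h powr (real DIM('a) + s + 1)" for h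
    by (simp add: riesz_kernel_def divide_inverse mult.commute)
  have cmp: "(norm (x + h))\<^sup>2 - (norm (x - h))\<^sup>2 = 4 * (h \<bullet> x)" for h
    by (simp add: power2_norm_eq_inner inner_add_left inner_add_right inner_diff_left inner_diff_right inner_commute)
  have p_le: "p h \<le> 0" for h
  proof (cases "0 \<le> h \<bullet> x")
    case True
    then have "(norm (x - h))\<^sup>2 \<le> (norm (x + h))\<^sup>2" using cmp[of h] by linarith
    then have "norm (x - h) \<le> norm (x + h)" by (rule power2_le_imp_le) simp
    then have "?w (x + h) - ?w (x - h) \<le> 0" by (simp add: indicator_def)
    moreover have "0 \<le> riesz_kernel s h \<bullet> x" using True by (simp add: kx)
    ultimately show ?thesis unfolding p by (rule mult_nonpos_nonneg)
  next
    case False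
    then have "(norm (x + h))\<^sup>2 \<le> (norm (x - h))\<^sup>2" using cmp[of h] by linarith
    then have "norm (x + h) \<le> norm (x - h)" by (rule power2_le_imp_le) simp
    then have "0 \<le> ?w (x + h) - ?w (x - h)" by (simp add: indicator_def)
    moreover have "riesz_kernel s h \<bullet> x \<le> 0" using False by (simp add: kx divide_nonpos_nonneg)
    ultimately show ?thesis unfolding p by (rule mult_nonneg_nonpos)
  qed
  have "0 \<le> (LINT h|lborel. - p h)"
    using p_le by (intro Bochner_Integration.integral_nonneg) auto
  then have "integral\<^sup>L lborel p \<le> 0" by simp
  then have le: "integral\<^sup>L lborel g \<le> 0" using intp by simp
  then show "riesz_grad c s ?w x \<bullet> x \<le> 0" using grad c by (simp add: mult_nonneg_nonpos)
  assume x0: "x \<noteq> 0" and xR: "norm x < R"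
  have "integral\<^sup>L lborel p \<noteq> 0"
  proof
    assume "integral\<^sup>L lborel p = 0"
    then have "AE h in lborel. - p h = 0"
      using integral_nonneg_eq_0_iff_AE[of lborel "\<lambda>h. - p h"] ip p_le by simp
    define S where "S = {h. 0 < h \<bullet> x} \<inter> {h. R < norm (x + h)} \<inter> {h. norm (x - h) < R}"
    have "open S"
      unfolding S_def by (intro open_Int open_Collect_less continuous_intros)
    have "p h \<noteq> 0" if "h \<in> S" for h
      using that by (auto simp: p kx S_def)
    with \<open>AE h in lborel. - p h = 0\<close> have "AE h in lborel. h \<notin> S" by (auto elim: eventually_mono)
    then have "S \<in> null_sets lborel"
      using \<open>open S\<close> by (subst (asm) AE_iff_null_sets[symmetric]) auto
    then have "negligible S"
      by (simp add: negligible_iff_null_sets null_sets_completion_iff null_sets_completionI)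
    \<comment> \<open>\<open>S\<close> is open, so one point suffices for positive measure: \<open>h\<close> is the vector of length \<open>R\<close> in the
      direction of \<open>x\<close>.\<close>
    moreover have "(R / norm x) *\<^sub>R x \<in> S"
    proof -
      have R: "0 < R" using xR norm_ge_zero[of x] by linarith
      have "x + (R / norm x) *\<^sub>R x = (1 + R / norm x) *\<^sub>R x" "x - (R / norm x) *\<^sub>R x = (1 - R / norm x) *\<^sub>R x"
        by (simp_all add: algebra_simps)
      moreover have "norm ((1 + R / norm x) *\<^sub>R x) = norm x + R"
        using R x0 by (simp add: distrib_right)
      moreover have "norm ((1 - R / norm x) *\<^sub>R x) = R - norm x"
      proof -
        have "1 - R / norm x \<le> 0" using xR x0 by simp
        then show ?thesis using x0 by (simp add: left_diff_distrib)
      qed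
      moreover have "0 < ((R / norm x) *\<^sub>R x) \<bullet> x" using R x0 by simp
      moreover have "R < norm x + R" "R - norm x < R" using x0 by simp_all
      ultimately show ?thesis unfolding S_def by (simp only: Int_iff mem_Collect_eq simp_thms)
    qed
    ultimately show False using open_not_negligible[OF \<open>open S\<close>] by blast
  qed
  then have "integral\<^sup>L lborel g < 0" using intp le by simp
  then show "riesz_grad c s ?w x \<bullet> x < 0" using grad c by (simp add: mult_pos_neg)
qed

text \<open>
  The component \<open>v\<close> of the gradient orthogonal to \<open>x\<close> is orthogonal to the gradient itself, so
  \<open>v \<bullet> v = 0\<close>.
\<close>

lemma riesz_grad_ball_radial:
  fixes x :: "'a::euclidean_space"
  assumes s: "0 < s" and c: "0 < c" and x: "norm x \<noteq> R" "x \<noteq> 0"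
  shows "\<exists>\<gamma>\<ge>0. riesz_grad c s (indicat_real (ball 0 R)) x = (- \<gamma>) *\<^sub>R x \<and> (norm x < R \<longrightarrow> 0 < \<gamma>)"
proof -
  let ?g = "riesz_grad c s (indicat_real (ball 0 R)) x"
  define \<gamma> where "\<gamma> = - (?g \<bullet> x) / (x \<bullet> x)"
  define v where "v = ?g + \<gamma> *\<^sub>R x"
  have "x \<bullet> v = 0" using x(2) by (simp add: v_def \<gamma>_def inner_add_right inner_diff_right inner_commute)
  moreover from this have "?g \<bullet> v = 0" by (rule riesz_grad_ball_orthogonal[OF s x(1)])
  moreover have "v \<bullet> v = ?g \<bullet> v + \<gamma> * (x \<bullet> v)"
    unfolding inner_scaleR_left[symmetric] inner_add_left[symmetric] by (simp only: v_def)
  ultimately have "v \<bullet> v = 0" by simp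
  then have "?g = (- \<gamma>) *\<^sub>R x" by (simp add: v_def add_eq_0_iff2)
  moreover have "0 \<le> \<gamma>" "norm x < R \<longrightarrow> 0 < \<gamma>"
    using riesz_grad_ball_inner_nonpos[OF s c x(1)] x(2)
    by (auto simp: \<gamma>_def divide_nonpos_nonneg divide_neg_pos)
  ultimately show ?thesis by blast
qed

section \<open>Sums of two balls\<close>

lemma riesz_grad_add_balls:
  fixes x z z' :: "'a::euclidean_space"
  assumes s: "0 < s" and x: "0 < sphere_dist z R x" "0 < sphere_dist z' R' x"
  shows "riesz_grad c s (\<lambda>x. indicat_real (ball z R) x + indicat_real (ball z' R') x) x
    = riesz_grad c s (indicat_real (ball z R)) x + riesz_grad c s (indicat_real (ball z' R')) x"
  using integrable_ball_difference[OF s x(1)] integrable_ball_difference[OF s x(2)]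
  by (simp add: riesz_grad_def add_diff_add scaleR_add_left scaleR_add_right del: ball_scale)

lemma frac_grad_two_balls:
  fixes z z' :: "'a::euclidean_space"
  assumes s: "0 < s" "s < 1" and R: "0 < R" "0 < R'"
  shows "AE x in lborel. frac_grad c s (\<lambda>x. indicat_real (ball z R) x + indicat_real (ball z' R') x) x
    = riesz_grad c s (indicat_real (ball z R)) x + riesz_grad c s (indicat_real (ball z' R')) x"
proof -
  let ?u = "\<lambda>x. indicat_real (ball z R) x + indicat_real (ball z' R') x"
  have "gagliardo_integrable s ?u"
    using Bochner_Integration.integrable_add[OF gagliardo_integrable_ball[OF s R(1), unfolded gagliardo_integrable_def, of z]
        gagliardo_integrable_ball[OF s R(2), unfolded gagliardo_integrable_def, of z']]
    by (simp add: gagliardo_integrable_def add_diff_add scaleR_add_left)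
  then have "AE x in lborel. frac_grad c s ?u x = riesz_grad c s ?u x"
    by (intro frac_grad_AE_eq_riesz_grad s Bochner_Integration.integrable_add integrable_indicator_ball)
  then show ?thesis
    using AE_sphere_dist_pos[of z R] AE_sphere_dist_pos[of z' R']
    by eventually_elim (simp add: riesz_grad_add_balls[OF s(1)])
qed

lemma integral_less_if_neq_on_set:
  fixes X Y :: "'a \<Rightarrow> real"
  assumes int: "integrable M X" "integrable M Y"
    and A: "emeasure M A \<noteq> 0" "A \<in> sets M" "AE x in M. x \<in> A \<longrightarrow> X x \<noteq> Y x"
    and le: "AE x in M. X x \<le> Y x"
  shows "integral\<^sup>L M X < integral\<^sup>L M Y"
proof -
  have nonneg: "AE x in M. 0 \<le> Y x - X x" using le by simp
  have "(LINT x|M. Y x - X x) \<noteq> 0"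
  proof
    assume "(LINT x|M. Y x - X x) = 0"
    then have "AE x in M. Y x - X x = 0"
      using integral_nonneg_eq_0_iff_AE[of M "\<lambda>x. Y x - X x"] int nonneg by simp
    then have "AE x in M. x \<notin> A" using A(3) by eventually_elim auto
    then show False using A(1,2) by (simp add: AE_iff_null_sets null_setsD1)
  qed
  then show ?thesis using integral_nonneg_AE[OF nonneg] int by simp
qed

lemma norm_add_less_if_inner_neg:
  fixes a b :: "'a::real_inner"
  assumes "a \<bullet> b < 0"
  shows "norm (a + b) < norm a + norm b"
proof -
  have "norm (a + b) \<noteq> norm a + norm b"
  proof
    assume "norm (a + b) = norm a + norm b"
    then have "a \<bullet> b = norm a * norm b"
      by (simp add: norm_triangle_eq norm_cauchy_schwarz_eq)
    then show False using assms by (metis mult_nonneg_nonneg norm_ge_zero not_less)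
  qed
  then show ?thesis using norm_triangle_ineq[of a b] by simp
qed

text \<open>
  On the right the two gradients are parallel, so the integral splits into two \<open>L\<^sup>1\<close> norms. The same
  two norms bound the left-hand side, with strict inequality because the gradients form an obtuse
  angle on the ball with diameter from \<open>0\<close> to \<open>e\<close>; the bounds on \<open>norm e\<close> place it inside both
  balls, where neither gradient vanishes except at a centre.
\<close>

lemma integral_norm_riesz_grad_balls_less:
  fixes e :: "'a::euclidean_space"
  assumes s: "0 < s" "s < 1" and c: "0 < c" and e: "e \<noteq> 0" "norm e \<le> R" "norm e \<le> r"
  shows "(LINT x|lborel. norm (riesz_grad c s (indicat_real (ball 0 R)) x + riesz_grad c s (indicat_real (ball e r)) x))
    < (LINT x|lborel. norm (riesz_grad c s (indicat_real (ball 0 R)) x + riesz_grad c s (indicat_real (ball (0::'a) r)) x))"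
proof -
  define A where "A = riesz_grad c s (indicat_real (ball (0::'a) R))"
  define B where "B = riesz_grad c s (indicat_real (ball (0::'a) r))"
  define B' where "B' = riesz_grad c s (indicat_real (ball e r))"
  have R: "0 < R" "0 < r" using e by (auto intro: less_le_trans[of _ "norm e"])
  have int: "integrable lborel A" "integrable lborel B" "integrable lborel B'"
    unfolding A_def B_def B'_def by (intro integrable_riesz_grad_ball s R)+
  have B': "B' x = B (x - e)" for x
    unfolding B_def B'_def by (rule riesz_grad_ball_translate)
  have radial_A: "\<exists>\<gamma>\<ge>0. A x = (- \<gamma>) *\<^sub>R x \<and> (norm x < R \<longrightarrow> 0 < \<gamma>)" if "norm x \<noteq> R" "x \<noteq> 0" for x
    unfolding A_def by (rule riesz_grad_ball_radial[OF s(1) c that])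
  have radial_B: "\<exists>\<gamma>\<ge>0. B x = (- \<gamma>) *\<^sub>R x \<and> (norm x < r \<longrightarrow> 0 < \<gamma>)" if "norm x \<noteq> r" "x \<noteq> 0" for x
    unfolding B_def by (rule riesz_grad_ball_radial[OF s(1) c that])
  have ne0: "AE x in lborel. x \<noteq> (0::'a)" by (rule AE_lborel_singleton)
  have "(LINT x|lborel. norm (A x + B' x)) < (LINT x|lborel. norm (A x) + norm (B' x))"
  proof (rule integral_less_if_neq_on_set)
    let ?S = "ball ((1/2) *\<^sub>R e) (norm e / 2)"
    have "0 < unit_ball_vol (real DIM('a))" by (rule unit_ball_vol_pos) simp
    then have "unit_ball_vol (real DIM('a)) \<noteq> 0" by linarith
    then show "emeasure lborel ?S \<noteq> 0" using e(1) by (simp add: emeasure_ball)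
    show "?S \<in> sets lborel" by simp
    show "AE x in lborel. x \<in> ?S \<longrightarrow> norm (A x + B' x) \<noteq> norm (A x) + norm (B' x)"
    proof (intro AE_I2 impI)
      fix x assume x: "x \<in> ?S"
      then have d: "norm (x - (1/2) *\<^sub>R e) < norm e / 2" by (simp add: dist_norm norm_minus_commute)
      \<comment> \<open>Thales: the angle subtended by a diameter is obtuse inside the ball.\<close>
      have "x \<bullet> (x - e) = (norm (x - (1/2) *\<^sub>R e))\<^sup>2 - (norm e / 2)\<^sup>2"
        by (simp add: power2_norm_eq_inner power_divide inner_diff_left inner_diff_right inner_commute)
      also have "\<dots> < 0" using d by (simp add: power_strict_mono)
      finally have neg: "x \<bullet> (x - e) < 0" .
      then have nz: "x \<noteq> 0" "x - e \<noteq> 0" by auto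
      have half: "norm ((1/2) *\<^sub>R e) = norm e / 2" by simp
      have "norm x < R"
        using d norm_triangle_sub[of x "(1/2) *\<^sub>R e"] e half by linarith
      then obtain \<alpha> where \<alpha>: "0 < \<alpha>" "A x = (- \<alpha>) *\<^sub>R x" using radial_A[of x] nz by auto
      have "x - e = (x - (1/2) *\<^sub>R e) - (1/2) *\<^sub>R e" by (simp add: algebra_simps flip: scaleR_add_left)
      then have "norm (x - e) \<le> norm (x - (1/2) *\<^sub>R e) + norm ((1/2) *\<^sub>R e)"
        using norm_triangle_ineq4[of "x - (1/2) *\<^sub>R e" "(1/2) *\<^sub>R e"] by (simp only:)
      then have "norm (x - e) < r" using d e half by linarith
      then obtain \<beta> where \<beta>: "0 < \<beta>" "B' x = (- \<beta>) *\<^sub>R (x - e)" using radial_B[of "x - e"] nz B' by auto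
      have "A x \<bullet> B' x = \<alpha> * \<beta> * (x \<bullet> (x - e))"
        unfolding \<alpha>(2) \<beta>(2) by simp
      also have "\<dots> < 0" using \<alpha>(1) \<beta>(1) neg by (simp add: mult_pos_neg)
      finally show "norm (A x + B' x) \<noteq> norm (A x) + norm (B' x)"
        using norm_add_less_if_inner_neg by fastforce
    qed
    show "AE x in lborel. norm (A x + B' x) \<le> norm (A x) + norm (B' x)"
      by (simp add: norm_triangle_ineq)
  qed (use int in auto)
  also have "\<dots> = (LINT x|lborel. norm (A x)) + (LINT x|lborel. norm (B' x))"
    using int by simp
  also have "(LINT x|lborel. norm (B' x)) = (LINT x|lborel. norm (B x))"
    using integral_lborel_shift[of "\<lambda>x. norm (B x)" "- e"] int by (simp add: B')
  also have "(LINT x|lborel. norm (A x)) + (LINT x|lborel. norm (B x)) = (LINT x|lborel. norm (A x) + norm (B x))"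
    using int by simp
  also have "\<dots> = (LINT x|lborel. norm (A x + B x))"
  proof (rule integral_cong_AE)
    show "AE x in lborel. norm (A x) + norm (B x) = norm (A x + B x)"
      using ne0 AE_sphere_dist_pos[of "0::'a" R] AE_sphere_dist_pos[of "0::'a" r]
    proof eventually_elim
      case (elim x)
      then obtain \<alpha> \<beta> where "0 \<le> \<alpha>" "A x = (- \<alpha>) *\<^sub>R x" "0 \<le> \<beta>" "B x = (- \<beta>) *\<^sub>R x"
        using radial_A[of x] radial_B[of x] by (auto simp: sphere_dist_def)
      moreover from this have "A x + B x = - ((\<alpha> + \<beta>) *\<^sub>R x)" by (simp add: scaleR_add_left)
      ultimately show ?case by (simp add: distrib_right)
    qed
  qed (use int in auto)
  finally show ?thesis by (simp add: A_def B_def B'_def)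
qed

section \<open>Passing from p = 1 to nearby exponents\<close>

lemma Lp_norm_cong_AE:
  assumes "AE x in lborel. f x = g x"
  shows "Lp_norm p f = Lp_norm p g"
proof -
  have "(\<integral>\<^sup>+x. ennreal (norm (f x) powr p) \<partial>lborel) = (\<integral>\<^sup>+x. ennreal (norm (g x) powr p) \<partial>lborel)"
    using assms by (intro nn_integral_cong_AE) (auto elim!: eventually_mono)
  then show ?thesis by (simp add: Lp_norm_def)
qed

lemma Lp_norm_eq:
  assumes "integrable lborel (\<lambda>x. norm (f x) powr p)"
  shows "Lp_norm p f = ennreal ((LINT x|lborel. norm (f x) powr p) powr (1 / p))"
proof -
  have "(\<integral>\<^sup>+x. ennreal (norm (f x) powr p) \<partial>lborel) = ennreal (LINT x|lborel. norm (f x) powr p)"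
    using assms by (intro nn_integral_eq_integral) auto
  moreover have "0 \<le> (LINT x|lborel. norm (f x) powr p)"
    by (intro Bochner_Integration.integral_nonneg) auto
  ultimately show ?thesis by (simp add: Lp_norm_def)
qed

lemma Lp_norm_1:
  fixes f :: "'a::euclidean_space \<Rightarrow> 'b::euclidean_space"
  assumes "integrable lborel f"
  shows "Lp_norm 1 f = ennreal (LINT x|lborel. norm (f x))"
  using Lp_norm_eq[of f 1] assms by simp

text \<open>
  For \<open>1 \<le> p \<le> q\<close> the \<open>p\<close>-th powers are dominated by \<open>|f| + |f| powr q\<close>.
\<close>

lemma Lp_norm_tendsto_1:
  fixes f :: "'a::euclidean_space \<Rightarrow> 'b::euclidean_space"
  assumes f: "integrable lborel f" and q: "1 < q"
    and fq: "integrable lborel (\<lambda>x. norm (f x) powr q)"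
  shows "((\<lambda>p. Lp_norm p f) \<longlongrightarrow> ennreal (LINT x|lborel. norm (f x))) (at_right 1)"
proof -
  have [measurable]: "f \<in> borel_measurable borel" using f by simp
  have bound: "norm (f x) powr p \<le> norm (f x) + norm (f x) powr q" if "1 \<le> p" "p \<le> q" for x p
  proof (cases "norm (f x) \<le> 1")
    case True
    then have "norm (f x) powr p \<le> norm (f x) powr 1" using that by (intro powr_mono') auto
    then show ?thesis by (simp add: add_increasing2)
  next
    case False
    then have "norm (f x) powr p \<le> norm (f x) powr q" using that by (intro powr_mono) auto
    then show ?thesis by (simp add: add_increasing)
  qed
  have dom: "integrable lborel (\<lambda>x. norm (f x) + norm (f x) powr q)" using f fq by simp
  have int: "integrable lborel (\<lambda>x. norm (f x) powr p)" if "1 \<le> p" "p \<le> q" for p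
  proof (rule Bochner_Integration.integrable_bound[OF dom])
    show "AE x in lborel. norm (norm (f x) powr p) \<le> norm (norm (f x) + norm (f x) powr q)"
      using bound[OF that] by simp
  qed simp
  have lim: "((\<lambda>p. LINT x|lborel. norm (f x) powr p) \<longlongrightarrow> (LINT x|lborel. norm (f x))) (at 1 within {1<..<q})"
    unfolding tendsto_at_iff_sequentially comp_def
  proof (intro allI impI)
    fix X :: "nat \<Rightarrow> real" assume X: "\<forall>i. X i \<in> {1<..<q} - {1}" "X \<longlonglongrightarrow> 1"
    show "(\<lambda>i. LINT x|lborel. norm (f x) powr X i) \<longlonglongrightarrow> (LINT x|lborel. norm (f x))"
    proof (rule integral_dominated_convergence[OF _ _ dom])
      show "AE x in lborel. (\<lambda>i. norm (f x) powr X i) \<longlonglongrightarrow> norm (f x)"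
      proof (rule AE_I2)
        fix x
        have "(\<lambda>i. norm (f x) powr X i) \<longlonglongrightarrow> norm (f x) powr 1"
          using X(2) by (intro tendsto_powr') auto
        then show "(\<lambda>i. norm (f x) powr X i) \<longlonglongrightarrow> norm (f x)" by simp
      qed
      show "AE x in lborel. norm (norm (f x) powr X i) \<le> norm (f x) + norm (f x) powr q" for i
        using bound[of "X i"] X(1) by (simp add: less_imp_le)
    qed auto
  qed
  have within: "at (1::real) within {1<..<q} = at_right 1"
    using q by (intro at_within_nhd[of _ "{..<q}"]) auto
  have "((\<lambda>p. (LINT x|lborel. norm (f x) powr p) powr (1 / p)) \<longlongrightarrow> (LINT x|lborel. norm (f x)) powr (1 / 1)) (at_right 1)"
    using lim unfolding within
    by (intro tendsto_powr' tendsto_intros) (auto intro!: always_eventually Bochner_Integration.integral_nonneg)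
  then have "((\<lambda>p. ennreal ((LINT x|lborel. norm (f x) powr p) powr (1 / p))) \<longlongrightarrow> ennreal (LINT x|lborel. norm (f x))) (at_right 1)"
    by (simp add: Bochner_Integration.integral_nonneg)
  moreover have "eventually (\<lambda>p. ennreal ((LINT x|lborel. norm (f x) powr p) powr (1 / p)) = Lp_norm p f) (at_right 1)"
    using eventually_at_right_less[of 1] eventually_at_right_field[of "\<lambda>p. p < q" 1] q
    by (auto simp: eventually_at_right_field intro!: exI[of _ q] Lp_norm_eq[symmetric] int)
  ultimately show ?thesis by (rule Lim_transform_eventually)
qed

lemma integrable_norm_powr_sum:
  fixes f g :: "'a::euclidean_space \<Rightarrow> 'b::euclidean_space"
  assumes [measurable]: "f \<in> borel_measurable borel" "g \<in> borel_measurable borel"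
    and q: "1 < q" and f: "(\<integral>\<^sup>+x. ennreal (norm (f x) powr q) \<partial>lborel) < \<infinity>"
    and g: "(\<integral>\<^sup>+x. ennreal (norm (g x) powr q) \<partial>lborel) < \<infinity>"
  shows "integrable lborel (\<lambda>x. norm (f x + g x) powr q)"
proof (rule Bochner_Integration.integrable_bound)
  have "integrable lborel (\<lambda>x. norm (f x) powr q)" "integrable lborel (\<lambda>x. norm (g x) powr q)"
    using f g by (auto intro!: integrableI_bounded)
  then show "integrable lborel (\<lambda>x. 2 powr q * (norm (f x) powr q + norm (g x) powr q))" by simp
  show "AE x in lborel. norm (norm (f x + g x) powr q) \<le> norm (2 powr q * (norm (f x) powr q + norm (g x) powr q))"
  proof (rule AE_I2)
    fix x
    define m where "m = max (norm (f x)) (norm (g x))"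
    have "norm (f x + g x) \<le> 2 * m" using norm_triangle_ineq[of "f x" "g x"] by (simp add: m_def)
    then have "norm (f x + g x) powr q \<le> (2 * m) powr q" using q by (intro powr_mono2) auto
    also have "\<dots> = 2 powr q * m powr q" by (rule powr_mult)
    also have "\<dots> \<le> 2 powr q * (norm (f x) powr q + norm (g x) powr q)"
      by (intro mult_left_mono) (auto simp: m_def max_def)
    finally show "norm (norm (f x + g x) powr q) \<le> norm (2 powr q * (norm (f x) powr q + norm (g x) powr q))"
      by simp
  qed
qed simp

section \<open>The symmetric decreasing rearrangement of nested balls\<close>

lemma set_rearr_eqI:
  fixes E :: "'a::euclidean_space set"
  assumes "emeasure lebesgue (ball (0::'a) r) = emeasure lebesgue E"
  shows "set_rearr E = ball 0 r"
  unfolding set_rearr_def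
proof (rule the_equality)
  show "(\<exists>r'. ball (0::'a) r = ball 0 r') \<and> emeasure lebesgue (ball (0::'a) r) = emeasure lebesgue E"
    using assms by blast
  have less: "emeasure lebesgue (ball (0::'a) a) < emeasure lebesgue (ball (0::'a) b)" if "a < b" "0 < b" for a b :: real
  proof -
    have "ball (0::'a) a = ball 0 (max 0 a)" by (auto simp: max_def)
    moreover have "max 0 a ^ DIM('a) < b ^ DIM('a)" using that by (intro power_strict_mono) auto
    ultimately show ?thesis using that by (simp add: emeasure_ball ennreal_less_iff)
  qed
  fix B :: "'a set"
  assume "(\<exists>r. B = ball 0 r) \<and> emeasure lebesgue B = emeasure lebesgue E"
  then obtain r' where B: "B = ball 0 r'" and eq: "emeasure lebesgue (ball (0::'a) r') = emeasure lebesgue (ball (0::'a) r)"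
    using assms by auto
  have "\<not> (r < r' \<and> 0 < r')" "\<not> (r' < r \<and> 0 < r)"
    using less[of r r'] less[of r' r] eq by auto
  then have "r = r' \<or> r \<le> 0 \<and> r' \<le> 0" by linarith
  then show "B = ball 0 r" unfolding B by (auto simp: ball_empty)
qed

text \<open>
  The superlevel sets at height \<open>t\<close> are the large ball for \<open>t\<close> in \<open>(0, 1)\<close>, the small ball for \<open>t\<close> in
  \<open>[1, 2)\<close> and empty for \<open>t \<ge> 2\<close>.
\<close>

lemma sym_decr_rearr_nested_balls:
  fixes z :: "'a::euclidean_space"
  assumes r: "0 \<le> r" and sub: "ball z r \<subseteq> ball 0 R"
  shows "sym_decr_rearr (\<lambda>x. indicat_real (ball 0 R) x + indicat_real (ball z r) x)
    = (\<lambda>x. indicat_real (ball 0 R) x + indicat_real (ball 0 r) x)"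
proof
  let ?u = "\<lambda>x. indicat_real (ball 0 R) x + indicat_real (ball z r) x"
  fix x :: 'a
  have low: "set_rearr {y. ?u y > t} = ball 0 R" if "0 < t" "t < 1" for t
  proof -
    have "{y. ?u y > t} = ball 0 R" using that sub by (auto simp: indicator_def)
    then show ?thesis using set_rearr_eqI[of R "ball 0 R"] by simp
  qed
  have mid: "set_rearr {y. ?u y > t} = ball 0 r" if "1 \<le> t" "t < 2" for t
  proof -
    have "{y. ?u y > t} = ball z r" using that sub by (auto simp: indicator_def)
    moreover have "emeasure lebesgue (ball (0::'a) r) = emeasure lebesgue (ball z r)"
      using r by (simp add: emeasure_ball)
    ultimately show ?thesis using set_rearr_eqI by metis
  qed
  have high: "set_rearr {y. ?u y > t} = {}" if "2 \<le> t" for t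
  proof -
    have "{y. ?u y > t} = {}" using that by (auto simp: indicator_def)
    then show ?thesis using set_rearr_eqI[of 0 "{}"] by simp
  qed
  have "sym_decr_rearr ?u x
      = (LINT (t::real)|lborel. indicat_real {0<..<1} t * indicat_real (ball 0 R) x + indicat_real {1..<2} t * indicat_real (ball 0 r) x)"
    unfolding sym_decr_rearr_def set_lebesgue_integral_def
  proof (rule Bochner_Integration.integral_cong[OF refl])
    fix t :: real
    consider "t \<le> 0" | "0 < t" "t < 1" | "1 \<le> t" "t < 2" | "2 \<le> t" by linarith
    then show "indicat_real {0<..} t *\<^sub>R indicat_real (set_rearr {y. ?u y > t}) x
      = indicat_real {0<..<1} t * indicat_real (ball 0 R) x + indicat_real {1..<2} t * indicat_real (ball 0 r) x"
      by cases (simp_all add: low mid high)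
  qed
  also have "\<dots> = indicat_real (ball 0 R) x + indicat_real (ball 0 r) x"
    by (subst Bochner_Integration.integral_add) auto
  finally show "sym_decr_rearr ?u x = indicat_real (ball 0 R) x + indicat_real (ball 0 r) x" .
qed

section \<open>The counterexample to the rearrangement inequality\<close>

theorem theorem1p1:
  fixes s c :: real and k :: "'n::finite" and u :: "real ^ 'n \<Rightarrow> real"
  assumes "0 < s" and "s < 1" and "0 < c"
    and "u = (\<lambda>x. indicat_real (ball 0 2) x + indicat_real (ball (axis k 1) 1) x)"
  shows "sym_decr_rearr u = (\<lambda>x. indicat_real (ball 0 2) x + indicat_real (ball 0 1) x) \<and>
    (\<exists>\<epsilon>>0. \<forall>p\<in>{1..1 + \<epsilon>}.
       Lp_norm p (frac_grad c s (sym_decr_rearr u)) > Lp_norm p (frac_grad c s u))"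
proof
  note s = assms(1,2) and c = assms(3) and u = assms(4)
  define e :: "real ^ 'n" where "e = axis k 1"
  have e: "norm e = 1" "e \<noteq> 0" by (simp_all add: e_def)
  have sub: "ball e 1 \<subseteq> ball 0 2"
  proof
    fix x assume "x \<in> ball e 1"
    then have "norm (x - e) < 1" by (simp add: dist_norm norm_minus_commute)
    then show "x \<in> ball 0 2" using norm_triangle_sub[of x e] e by simp
  qed
  show rearr: "sym_decr_rearr u = (\<lambda>x. indicat_real (ball 0 2) x + indicat_real (ball 0 1) x)"
    unfolding u using sym_decr_rearr_nested_balls[OF _ sub] by (simp add: e_def)
  define A where "A = riesz_grad c s (indicat_real (ball (0::real ^ 'n) 2))"
  define B where "B = riesz_grad c s (indicat_real (ball (0::real ^ 'n) 1))"
  define B' where "B' = riesz_grad c s (indicat_real (ball e 1))"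
  have Lp_star: "Lp_norm p (frac_grad c s (sym_decr_rearr u)) = Lp_norm p (\<lambda>x. A x + B x)" for p
    unfolding rearr A_def B_def by (intro Lp_norm_cong_AE frac_grad_two_balls s) auto
  have Lp_u: "Lp_norm p (frac_grad c s u) = Lp_norm p (\<lambda>x. A x + B' x)" for p
    unfolding u A_def B'_def e_def[symmetric] by (intro Lp_norm_cong_AE frac_grad_two_balls s) auto
  have int: "integrable lborel A" "integrable lborel B" "integrable lborel B'"
    unfolding A_def B_def B'_def by (intro integrable_riesz_grad_ball s; simp)+
  then have ABm: "A \<in> borel_measurable borel" "B \<in> borel_measurable borel" "B' \<in> borel_measurable borel"
    by auto
  have AB: "integrable lborel (\<lambda>x. A x + B x)" "integrable lborel (\<lambda>x. A x + B' x)" using int by auto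
  have less: "(LINT x|lborel. norm (A x + B' x)) < (LINT x|lborel. norm (A x + B x))"
    unfolding A_def B_def B'_def
    by (rule integral_norm_riesz_grad_balls_less[OF s c e(2)]) (simp_all add: e(1))
  then have less': "ennreal (LINT x|lborel. norm (A x + B' x)) < ennreal (LINT x|lborel. norm (A x + B x))"
    by (intro ennreal_lessI) (auto intro!: le_less_trans[OF _ less] Bochner_Integration.integral_nonneg)
  \<comment> \<open>Any exponent strictly between \<open>1\<close> and \<open>1 / s\<close> would do.\<close>
  define q where "q = (1 + 1 / s) / 2"
  have q: "1 < q" "q * s < 1" using s by (auto simp: q_def field_simps)
  have fin: "(\<integral>\<^sup>+x. ennreal (norm (A x) powr q) \<partial>lborel) < \<infinity>" "(\<integral>\<^sup>+x. ennreal (norm (B x) powr q) \<partial>lborel) < \<infinity>"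
    "(\<integral>\<^sup>+x. ennreal (norm (B' x) powr q) \<partial>lborel) < \<infinity>"
    unfolding A_def B_def B'_def
    using q by (intro nn_integral_riesz_grad_ball_powr_finite s; simp)+
  have lim_star: "((\<lambda>p. Lp_norm p (\<lambda>x. A x + B x)) \<longlongrightarrow> ennreal (LINT x|lborel. norm (A x + B x))) (at_right 1)"
    by (intro Lp_norm_tendsto_1[OF AB(1) q(1)] integrable_norm_powr_sum ABm fin q)
  have lim_u: "((\<lambda>p. Lp_norm p (\<lambda>x. A x + B' x)) \<longlongrightarrow> ennreal (LINT x|lborel. norm (A x + B' x))) (at_right 1)"
    by (intro Lp_norm_tendsto_1[OF AB(2) q(1)] integrable_norm_powr_sum ABm fin q)
  obtain m where m: "ennreal (LINT x|lborel. norm (A x + B' x)) < m" "m < ennreal (LINT x|lborel. norm (A x + B x))"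
    using dense[OF less'] by blast
  have "eventually (\<lambda>p. Lp_norm p (\<lambda>x. A x + B' x) < Lp_norm p (\<lambda>x. A x + B x)) (at_right 1)"
    using order_tendstoD(2)[OF lim_u m(1)] order_tendstoD(1)[OF lim_star m(2)]
    by eventually_elim (rule less_trans)
  then obtain b where b: "1 < b" "\<And>p. 1 < p \<Longrightarrow> p < b \<Longrightarrow> Lp_norm p (\<lambda>x. A x + B' x) < Lp_norm p (\<lambda>x. A x + B x)"
    by (auto simp: eventually_at_right_field)
  show "\<exists>\<epsilon>>0. \<forall>p\<in>{1..1 + \<epsilon>}. Lp_norm p (frac_grad c s (sym_decr_rearr u)) > Lp_norm p (frac_grad c s u)"
  \<comment> \<open>The strict inequality is known for \<open>p < b\<close> only, while the interval for \<open>p\<close> is closed.\<close>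
  proof (intro exI[of _ "(b - 1) / 2"] conjI ballI)
    show "0 < (b - 1) / 2" using b by simp
    fix p assume p: "p \<in> {1..1 + (b - 1) / 2}"
    have "p < b" using p b(1) by (auto simp: field_simps)
    then show "Lp_norm p (frac_grad c s u) < Lp_norm p (frac_grad c s (sym_decr_rearr u))"
      unfolding Lp_star Lp_u using p b(2)[of p] less' Lp_norm_1[OF AB(1)] Lp_norm_1[OF AB(2)]
      by (cases "p = 1") auto
  qed
qed

end
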